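(* Let $n\in\mathbb{N}$. (i) An even entire function $f(z)=g(z^2)$ (with $g$ entire) preserves nonnegativity of symmetric matrices of order $n$ if and only if the divided differences of $g$ up to order $n$ are nonnegative on $\mathbb{R}_+$, i.e., $g[x_1,\ldots,x_k]\ge 0$ for all $x_1,\ldots,x_k\ge 0$ and $k=1,\ldots,n$. (ii) An odd entire function $f(z)=z\,h(z^2)$ (with $h$ entire) preserves nonnegativity of symmetric matrices of order $n$ if and only if $h[x_1,\ldots,x_k]\ge 0$ for all $x_1,\ldots,x_k\ge 0$ and $k=1,\ldots,n$.
   Context: $\mathbb{R}_+=[0,\infty)$. An entire function $f$ preserves nonnegativity of symmetric matrices of order $n$ if $f(A)$ is entrywise nonnegative for every entrywise nonnegative symmetric $A\in\mathbb{R}^{n\times n}$, where for $f(z)=\sum_{j\ge0}a_jz^j$ one has $f(A)=\sum_{j\ge0}a_jA^j$. Inequalities "$\ge 0$" for complex-valued expressions mean real and nonnegative. The divided difference of a smooth function $g$ at points $x_1,\ldots,x_k$ (which can be thought of as ordered, $x_1\le\cdots\le x_k$; divided differences are symmetric in the points) is defined by $g[x]=g(x)$ and $$g[x_1,\ldots,x_k]=\begin{cases}\dfrac{g[x_2,\ldots,x_k]-g[x_1,\ldots,x_{k-1}]}{x_k-x_1}, & x_1\ne x_k,\\[2mm] g^{(k-1)}(x_1)/(k-1)!, & x_1=x_k.\end{cases}$$ The divided difference at $k$ points is said to be of order $k$. *)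

theory Defs
  imports
    "HOL-Complex_Analysis.Complex_Analysis"
    "HOL-Library.Complex_Order"
    "Jordan_Normal_Form.Matrix"
begin

text \<open>
  The order on the complex numbers is the partial order of
  \<^theory>\<open>HOL-Library.Complex_Order\<close>: \<^term>\<open>0 \<le> (z :: complex)\<close> means that \<open>z\<close> is real and nonnegative.
\<close>

definition nonneg_mat :: "'a :: {zero, ord} mat \<Rightarrow> bool" where
  "nonneg_mat A \<longleftrightarrow> (\<forall>i < dim_row A. \<forall>j < dim_col A. 0 \<le> A $$ (i, j))"

definition symmetric_mat :: "'a mat \<Rightarrow> bool" where
  "symmetric_mat A \<longleftrightarrow> transpose_mat A = A"

text \<open>
  The matrix series for \<open>f(A)\<close>, summed entry by entry, with coefficients the Taylor
  coefficients of \<open>f\<close> at 0. For a square matrix and an entire \<open>f\<close> all these series converge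
  absolutely. The coefficients may be complex, so the result is a complex matrix.
\<close>

definition mat_fun :: "(complex \<Rightarrow> complex) \<Rightarrow> real mat \<Rightarrow> complex mat" where
  "mat_fun f A = mat (dim_row A) (dim_col A)
     (\<lambda>(i, j). \<Sum>k. fps_nth (fps_expansion f 0) k * complex_of_real ((A ^\<^sub>m k) $$ (i, j)))"

definition preserves_nonneg_symmetric :: "nat \<Rightarrow> (complex \<Rightarrow> complex) \<Rightarrow> bool" where
  "preserves_nonneg_symmetric n f \<longleftrightarrow>
     (\<forall>A \<in> carrier_mat n n. symmetric_mat A \<longrightarrow> nonneg_mat A \<longrightarrow> nonneg_mat (mat_fun f A))"

text \<open>
  The recursion below is meant for sorted lists of points only: there, equal first and last
  points mean that all points coincide. The value on the empty list is irrelevant.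
  The functions considered are entire, so their derivatives along the real line are
  the complex derivatives.
\<close>

fun divided_difference_sorted :: "(complex \<Rightarrow> complex) \<Rightarrow> real list \<Rightarrow> complex" where
  "divided_difference_sorted g [] = 0"
| "divided_difference_sorted g [x] = g (complex_of_real x)"
| "divided_difference_sorted g (x # y # zs) =
     (if x \<noteq> last (y # zs)
      then (divided_difference_sorted g (y # zs)
              - divided_difference_sorted g (butlast (x # y # zs)))
            / complex_of_real (last (y # zs) - x)
      else (deriv ^^ (length (y # zs))) g (complex_of_real x) / fact (length (y # zs)))"

text \<open>Divided differences do not depend on the order of the points.\<close>

definition divided_difference :: "(complex \<Rightarrow> complex) \<Rightarrow> real list \<Rightarrow> complex" where
  "divided_difference g xs = divided_difference_sorted g (sort xs)"

definition nonneg_divided_differences :: "nat \<Rightarrow> (complex \<Rightarrow> complex) \<Rightarrow> bool" where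
  "nonneg_divided_differences n g \<longleftrightarrow>
     (\<forall>k \<in> {1..n}. \<forall>xs. length xs = k \<longrightarrow> (\<forall>x \<in> set xs. 0 \<le> x) \<longrightarrow>
        0 \<le> divided_difference g xs)"

end

theory Submission
  imports Defs "Jordan_Normal_Form.Char_Poly"
begin

text \<open>
  Put \<open>B = A\<^sup>2\<close>. Sufficiency: an entry \<open>(B\<^sup>m)\<^sub>i\<^sub>j\<close> counts weighted walks; splitting a walk from \<open>i\<close>
  to \<open>j\<close> at its last visit to \<open>i\<close>, and recursively on the remaining vertices, turns it into a sum over
  self-avoiding paths of convolutions of sequences \<open>(B\<^sub>S\<^sup>m)\<^sub>k\<^sub>k\<close>, with \<open>B\<^sub>S\<close> a principal submatrix of \<open>B\<close>.
  As \<open>B\<^sub>S\<close> is positive semidefinite, these are moments of positive measures on the half-line, and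
  the convolution of the sequences \<open>x\<^sub>1\<^sup>m, \<dots>, x\<^sub>k\<^sup>m\<close> is, up to an index shift, the divided difference of
  \<open>t\<^sup>m\<close> at \<open>x\<^sub>1, \<dots>, x\<^sub>k\<close>. So every entry of \<open>g(B)\<close> is a nonnegative combination of divided
  differences of \<open>g\<close> of order at most \<open>n\<close>, and the odd case follows by multiplying with \<open>A\<close>.

  Necessity: let \<open>A\<close> have entries \<open>s\<close> on the antidiagonal and \<open>e\<close> on the one above it. Then \<open>A\<^sup>2\<close> is a
  tridiagonal perturbation of \<open>s\<^sup>2 I\<close>, and as \<open>e\<close> tends to \<open>0\<close> an entry of \<open>g(A\<^sup>2)\<close>, divided by \<open>e\<^sup>l\<close>, tends
  to a positive multiple of \<open>g\<^bsup>(l)\<^esup>(s\<^sup>2)\<close>. Nonnegativity of the derivatives on the half-line yields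
  that of the divided differences.
\<close>

section \<open>Divided differences of monomials\<close>

text \<open>Divided differences of \<open>t\<^sup>m\<close>; the last equation is the Leibniz rule for \<open>t \<cdot> t\<^sup>m\<close>.\<close>

fun dd_pow :: "nat \<Rightarrow> real list \<Rightarrow> real" where
  "dd_pow m [] = 0"
| "dd_pow 0 (x # xs) = (if xs = [] then 1 else 0)"
| "dd_pow (Suc m) (x # xs) = x * dd_pow m (x # xs) + dd_pow m xs"

lemma dd_pow_singleton [simp]: "dd_pow m [x] = x ^ m"
  by (induction m) auto

lemma dd_pow_0: "dd_pow 0 xs = (if length xs = 1 then 1 else 0)"
  by (cases xs) auto

text \<open>The recursion of divided differences, cleared of its denominator so that it survives
  \<open>x = y\<close>. It acts on the first two points of the list; symmetry later carries it to
  the first and last points.\<close>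

lemma dd_pow_diff: "(x - y) * dd_pow m (x # y # zs) = dd_pow m (x # zs) - dd_pow m (y # zs)"
proof (induction m)
  case (Suc m)
  have "(x - y) * dd_pow (Suc m) (x # y # zs) =
      x * ((x - y) * dd_pow m (x # y # zs)) + (x - y) * dd_pow m (y # zs)"
    by (simp add: algebra_simps)
  also have "\<dots> = x * (dd_pow m (x # zs) - dd_pow m (y # zs)) + (x - y) * dd_pow m (y # zs)"
    by (simp only: Suc)
  finally show ?case
    by (simp add: algebra_simps)
qed auto

lemma dd_pow_swap: "dd_pow m (x # y # zs) = dd_pow m (y # x # zs)"
proof (cases "x = y")
  case False
  have "(x - y) * dd_pow m (x # y # zs) = (x - y) * dd_pow m (y # x # zs)"
    using dd_pow_diff[of x y m zs] dd_pow_diff[of y x m zs] by (simp add: algebra_simps)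
  with False show ?thesis
    by simp
qed simp

lemma dd_pow_Cons_cong:
  assumes "\<And>m. dd_pow m xs = dd_pow m ys" "length xs = length ys"
  shows "dd_pow m (x # xs) = dd_pow m (x # ys)"
  using assms by (induction m) auto

lemma dd_pow_move: "dd_pow m (ys @ x # zs) = dd_pow m (x # ys @ zs)"
proof (induction ys arbitrary: m)
  case (Cons y ys)
  have "dd_pow m (y # ys @ x # zs) = dd_pow m (y # x # ys @ zs)"
    by (rule dd_pow_Cons_cong) (use Cons in auto)
  then show ?case
    by (simp add: dd_pow_swap)
qed simp

text \<open>Adjacent transpositions generate all permutations. Symmetry reconciles
  \<open>dd_pow\<close>, which peels off the head, with \<open>divided_difference_sorted\<close>,
  which drops a point at either end.\<close>

lemma dd_pow_cong_mset: "mset xs = mset ys \<Longrightarrow> dd_pow m xs = dd_pow m ys"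
proof (induction xs arbitrary: ys m)
  case (Cons x xs)
  then obtain us vs where ys: "ys = us @ x # vs"
    by (metis list.set_intros(1) mset_eq_setD split_list)
  with Cons.prems have "mset xs = mset (us @ vs)"
    by simp
  with Cons.IH have "dd_pow m (x # xs) = dd_pow m (x # us @ vs)"
    by (intro dd_pow_Cons_cong mset_eq_length) auto
  then show ?case
    by (simp add: ys dd_pow_move)
qed simp

text \<open>Unrolls the Leibniz equation: adding the point \<open>x\<close> means convolving with
  the powers of \<open>x\<close>, delayed by one index. For \<open>xs = []\<close> the right-hand
  side would be \<open>0\<close> instead of \<open>x ^ m\<close>.\<close>

lemma dd_pow_conv:
  assumes "xs \<noteq> []"
  shows "dd_pow m (x # xs) = (\<Sum>a<m. x ^ a * dd_pow (m - 1 - a) xs)"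
proof (induction m)
  case (Suc m)
  have "(\<Sum>a<Suc m. x ^ a * dd_pow (Suc m - 1 - a) xs) =
      dd_pow m xs + (\<Sum>a<m. x ^ Suc a * dd_pow (m - Suc a) xs)"
    by (subst sum.lessThan_Suc_shift) simp
  also have "\<dots> = dd_pow m xs + x * dd_pow m (x # xs)"
    by (simp add: Suc sum_distrib_left mult.assoc)
  finally show ?case
    by simp
qed (use assms in auto)

lemma dd_pow_replicate:
  fixes x :: real
  shows "dd_pow m (replicate (Suc k) x) = (m choose k) * x ^ (m - k)"
proof (induction m arbitrary: k)
  case (Suc m)
  show ?case
  proof (cases k)
    case (Suc j)
    \<comment> \<open>Prepares Pascal's rule with \<open>k = Suc j\<close>. For \<open>m < k\<close>
      the truncated exponents disagree, but the binomial coefficient vanishes.\<close>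
    have "x * ((m choose k) * x ^ (m - k)) = (m choose k) * x ^ (m - j)"
    proof (cases "m < k")
      case False
      then have "m - j = Suc (m - k)"
        using Suc by simp
      then show ?thesis
        by simp
    qed simp
    then show ?thesis
      using Suc.IH[of k] Suc.IH[of j] by (simp add: Suc algebra_simps)
  qed simp
qed (simp add: dd_pow_0)

text \<open>At \<open>k + 1\<close> points, \<open>dd_pow m\<close> is the complete homogeneous
  symmetric polynomial of degree \<open>m - k\<close>, and zero if \<open>m < k\<close>. Keeping
  \<open>t ^ k\<close> on the left avoids truncated subtraction.\<close>

lemma dd_pow_scale: "length xs = Suc k \<Longrightarrow> t ^ k * dd_pow m (map ((*) t) xs) = t ^ m * dd_pow m xs"
proof (induction m arbitrary: xs k)
  case (Suc m)
  obtain x ys where xs: "xs = x # ys"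
    using Suc.prems by (cases xs) auto
  show ?case
  proof (cases k)
    case 0
    then show ?thesis
      using Suc.prems by (simp add: xs power_mult_distrib)
  next
    case k: (Suc j)
    have 1: "t ^ k * dd_pow m (map ((*) t) xs) = t ^ m * dd_pow m xs"
      and 2: "t ^ j * dd_pow m (map ((*) t) ys) = t ^ m * dd_pow m ys"
      using Suc.prems by (intro Suc.IH; simp add: xs k)+
    have "t ^ k * dd_pow (Suc m) (map ((*) t) xs) =
        t * x * (t ^ k * dd_pow m (map ((*) t) xs)) + t * (t ^ j * dd_pow m (map ((*) t) ys))"
      by (simp add: xs k algebra_simps)
    also have "\<dots> = t ^ Suc m * dd_pow (Suc m) xs"
      unfolding 1 2 by (simp add: xs algebra_simps)
    finally show ?thesis .
  qed
qed (simp add: dd_pow_0)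

text \<open>Passing from \<open>R\<close> to \<open>R + 1\<close> absorbs the second summand of the
  Leibniz equation, so the bound is independent of the number of points.\<close>

lemma dd_pow_bound:
  assumes "\<And>x. x \<in> set xs \<Longrightarrow> \<bar>x\<bar> \<le> R" "0 \<le> R"
  shows "\<bar>dd_pow m xs\<bar> \<le> (R + 1) ^ m"
  using assms(1)
proof (induction m arbitrary: xs)
  case (Suc m)
  show ?case
  proof (cases xs)
    case (Cons x ys)
    have "\<bar>x * dd_pow m (x # ys) + dd_pow m ys\<bar> \<le> R * (R + 1) ^ m + (R + 1) ^ m"
      using Suc.IH[of xs] Suc.IH[of ys] Suc.prems assms(2)
      by (intro order.trans[OF abs_triangle_ineq] add_mono)
         (auto simp: abs_mult Cons intro!: mult_mono)
    then show ?thesis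
      by (simp add: Cons algebra_simps)
  qed (use assms in simp)
qed (simp add: dd_pow_0)

section \<open>Entire functions applied to geometrically bounded sequences\<close>

definition taylor_coeff :: "(complex \<Rightarrow> complex) \<Rightarrow> nat \<Rightarrow> complex" where
  "taylor_coeff g m = fps_nth (fps_expansion g 0) m"

definition geom_bounded :: "(nat \<Rightarrow> real) \<Rightarrow> bool" where
  "geom_bounded u \<longleftrightarrow> (\<exists>K R. 0 \<le> K \<and> 0 \<le> R \<and> (\<forall>m. \<bar>u m\<bar> \<le> K * R ^ m))"

text \<open>The linear functional sending the monomial of degree \<open>m\<close> to
  \<open>u m\<close>, applied to \<open>g\<close>. Powers of a point give a value of
  \<open>g\<close>, the sequences \<open>dd_pow\<close> give divided differences, and the entries of
  matrix powers give an entry of the matrix function.\<close>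

definition taylor_app :: "(complex \<Rightarrow> complex) \<Rightarrow> (nat \<Rightarrow> real) \<Rightarrow> complex" where
  "taylor_app g u = (\<Sum>m. taylor_coeff g m * complex_of_real (u m))"

lemma taylor_coeff_altdef: "taylor_coeff g m = (deriv ^^ m) g 0 / fact m"
  by (simp add: taylor_coeff_def fps_expansion_def)

lemma geom_boundedI: "(\<And>m. \<bar>u m\<bar> \<le> K * R ^ m) \<Longrightarrow> 0 \<le> K \<Longrightarrow> 0 \<le> R \<Longrightarrow> geom_bounded u"
  unfolding geom_bounded_def by blast

lemma geom_bounded_dd_pow: "geom_bounded (\<lambda>m. dd_pow m xs)"
proof -
  define R where "R = (\<Sum>x\<leftarrow>xs. \<bar>x\<bar>)"
  have "\<bar>x\<bar> \<le> R" if "x \<in> set xs" for x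
    unfolding R_def using that by (intro member_le_sum_list) auto
  moreover have "0 \<le> R"
    unfolding R_def by (rule sum_list_nonneg) auto
  ultimately show ?thesis
    using dd_pow_bound[of xs R] by (intro geom_boundedI[of _ 1 "R + 1"]) auto
qed

lemma geom_bounded_zero: "geom_bounded (\<lambda>_. 0)"
  by (rule geom_boundedI[of _ 0 0]) auto

lemma geom_bounded_add:
  assumes "geom_bounded u" "geom_bounded v"
  shows "geom_bounded (\<lambda>m. u m + v m)"
proof -
  from assms(1) obtain K R where *: "0 \<le> K" "0 \<le> R" "\<And>m. \<bar>u m\<bar> \<le> K * R ^ m"
    unfolding geom_bounded_def by blast
  from assms(2) obtain K' R' where **: "0 \<le> K'" "0 \<le> R'" "\<And>m. \<bar>v m\<bar> \<le> K' * R' ^ m"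
    unfolding geom_bounded_def by blast
  have "\<bar>u m + v m\<bar> \<le> (K + K') * (max R R') ^ m" for m
  proof -
    have "\<bar>u m\<bar> \<le> K * (max R R') ^ m" "\<bar>v m\<bar> \<le> K' * (max R R') ^ m"
      using * **
      by (auto intro!: order_trans[OF *(3)] order_trans[OF **(3)] mult_left_mono power_mono)
    then show ?thesis
      by (simp add: algebra_simps)
  qed
  then show ?thesis
    using * ** by (intro geom_boundedI[of _ "K + K'" "max R R'"]) auto
qed

lemma geom_bounded_cmult:
  assumes "geom_bounded u"
  shows "geom_bounded (\<lambda>m. c * u m)"
proof -
  from assms obtain K R where *: "0 \<le> K" "0 \<le> R" "\<And>m. \<bar>u m\<bar> \<le> K * R ^ m"
    unfolding geom_bounded_def by blast
  have "\<bar>c * u m\<bar> \<le> (\<bar>c\<bar> * K) * R ^ m" for m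
    using *(3)[of m] by (simp add: abs_mult mult.assoc mult_left_mono)
  then show ?thesis
    using * by (intro geom_boundedI[of _ "\<bar>c\<bar> * K" R]) auto
qed

context
  fixes g :: "complex \<Rightarrow> complex"
  assumes g: "g holomorphic_on UNIV"
begin

lemma taylor_sums: "(\<lambda>m. taylor_coeff g m * z ^ m) sums g z"
  using holomorphic_power_series[of g 0 "norm z + 1" z] holomorphic_on_subset[OF g]
  by (simp add: taylor_coeff_altdef)

lemma summable_taylor_norm:
  assumes "0 \<le> R"
  shows "summable (\<lambda>m. norm (taylor_coeff g m) * R ^ m)"
proof -
  have "summable (\<lambda>m. norm (taylor_coeff g m * complex_of_real R ^ m))"
    by (rule powser_insidea[OF sums_summable[OF taylor_sums[of "complex_of_real (R + 1)"]]])
       (use assms in \<open>simp add: norm_of_real del: of_real_add\<close>)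
  then show ?thesis
    using assms by (simp add: norm_mult norm_power)
qed

lemma summable_taylor_app:
  assumes "geom_bounded u"
  shows "summable (\<lambda>m. taylor_coeff g m * complex_of_real (u m))"
proof -
  from assms obtain K R where *: "0 \<le> K" "0 \<le> R" "\<And>m. \<bar>u m\<bar> \<le> K * R ^ m"
    unfolding geom_bounded_def by blast
  show ?thesis
  proof (rule summable_comparison_test')
    show "summable (\<lambda>m. K * (norm (taylor_coeff g m) * R ^ m))"
      by (intro summable_mult summable_taylor_norm *)
    show "norm (taylor_coeff g m * complex_of_real (u m)) \<le> K * (norm (taylor_coeff g m) * R ^ m)" for m
      using mult_left_mono[OF *(3)[of m], of "norm (taylor_coeff g m)"]
      by (simp add: norm_mult algebra_simps)
  qed
qed

lemma taylor_app_zero: "taylor_app g (\<lambda>_. 0) = 0"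
  by (simp add: taylor_app_def)

lemma taylor_app_add:
  assumes "geom_bounded u" "geom_bounded v"
  shows "taylor_app g (\<lambda>m. u m + v m) = taylor_app g u + taylor_app g v"
  using suminf_add[OF summable_taylor_app[OF assms(1)] summable_taylor_app[OF assms(2)]]
  by (simp add: taylor_app_def algebra_simps)

lemma taylor_app_cmult:
  assumes "geom_bounded u"
  shows "taylor_app g (\<lambda>m. c * u m) = complex_of_real c * taylor_app g u"
  using suminf_mult[OF summable_taylor_app[OF assms], of "complex_of_real c"]
  by (simp add: taylor_app_def algebra_simps)

lemma higher_deriv_taylor:
  "(deriv ^^ k) g (complex_of_real x) / fact k = taylor_app g (\<lambda>m. dd_pow m (replicate (Suc k) x))"
proof -
  define D where "D = (deriv ^^ k) g"
  have D: "D holomorphic_on UNIV"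
    unfolding D_def by (rule holomorphic_higher_deriv[OF g]) auto
  have "(\<lambda>m. (deriv ^^ m) D 0 / fact m * complex_of_real x ^ m) sums D (complex_of_real x)"
    using holomorphic_power_series[of D 0 "\<bar>x\<bar> + 1" "complex_of_real x"] holomorphic_on_subset[OF D]
    by simp
  then have "(\<lambda>m. (deriv ^^ m) D 0 / fact m * complex_of_real x ^ m / fact k) sums (D (complex_of_real x) / fact k)"
    by (rule sums_divide)
  also have "(\<lambda>m. (deriv ^^ m) D 0 / fact m * complex_of_real x ^ m / fact k) =
      (\<lambda>m. taylor_coeff g (m + k) * complex_of_real (dd_pow (m + k) (replicate (Suc k) x)))"
  proof
    fix m
    have "(deriv ^^ m) D 0 = (deriv ^^ (m + k)) g 0"
      by (simp add: D_def funpow_add)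
    moreover have "complex_of_real (real (m + k choose k)) = fact (m + k) / (fact k * fact m)"
      by (subst binomial_fact) auto
    ultimately show "(deriv ^^ m) D 0 / fact m * complex_of_real x ^ m / fact k =
      taylor_coeff g (m + k) * complex_of_real (dd_pow (m + k) (replicate (Suc k) x))"
      unfolding dd_pow_replicate taylor_coeff_altdef of_real_mult of_real_of_nat_eq
      by simp
  qed
  \<comment> \<open>Undoing the index shift by \<open>k\<close> adds the terms with
    \<open>m < k\<close>, which vanish together with their binomial coefficients.\<close>
  finally have "(\<lambda>m. taylor_coeff g m * complex_of_real (dd_pow m (replicate (Suc k) x))) sums
      (D (complex_of_real x) / fact k + (\<Sum>m<k. taylor_coeff g m * complex_of_real (dd_pow m (replicate (Suc k) x))))"
    by (subst (asm) sums_iff_shift)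
  also have "(\<Sum>m<k. taylor_coeff g m * complex_of_real (dd_pow m (replicate (Suc k) x))) = 0"
    unfolding dd_pow_replicate by (intro sum.neutral) auto
  finally show ?thesis
    by (simp add: taylor_app_def sums_iff D_def)
qed

lemma divided_difference_sorted_taylor:
  "xs \<noteq> [] \<Longrightarrow> sorted xs \<Longrightarrow> divided_difference_sorted g xs = taylor_app g (\<lambda>m. dd_pow m xs)"
proof (induction "length xs" arbitrary: xs rule: less_induct)
  case less
  consider x where "xs = [x]" | x y zs where "xs = x # y # zs"
    using less.prems(1) by (metis neq_Nil_conv)
  then show ?case
  proof cases
    case 1
    then show ?thesis
      using taylor_sums[of "complex_of_real x"] by (simp add: taylor_app_def sums_iff)
  next
    case (2 x y zs)
    define l ws where "l = last (y # zs)" and "ws = butlast (y # zs)"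
    have yzs: "y # zs = ws @ [l]"
      by (simp add: l_def ws_def)
    show ?thesis
    proof (cases "x = l")
      case True
      have "sorted (x # ws @ [l])"
        using less.prems 2 yzs by simp
      \<comment> \<open>Sortedness squeezes every point between the equal first and last
        ones.\<close>
      then have "\<forall>w\<in>set (y # zs). w = x"
        unfolding yzs using True by (auto simp: sorted_append intro: antisym)
      then have "y # zs = replicate (length (y # zs)) x"
        by (metis replicate_length_same)
      then have rep: "xs = replicate (Suc (length (y # zs))) x"
        unfolding 2 by simp
      have "divided_difference_sorted g xs =
          (deriv ^^ length (y # zs)) g (complex_of_real x) / fact (length (y # zs))"
        using True by (simp only: 2 divided_difference_sorted.simps(3) l_def[symmetric] if_False simp_thms)
      also have "\<dots> = taylor_app g (\<lambda>m. dd_pow m xs)"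
        unfolding higher_deriv_taylor rep[symmetric] by (rule refl)
      finally show ?thesis .
    next
      case False
      have butl: "butlast (x # y # zs) = x # ws"
        by (simp add: ws_def)
      have sorted: "sorted (y # zs)" "sorted (x # ws)"
        using less.prems(2) unfolding 2 yzs by (auto simp: sorted_append)
      have "length (x # ws) < length xs"
        using arg_cong[OF yzs, of length] by (simp add: 2)
      with sorted have IH:
          "divided_difference_sorted g (y # zs) = taylor_app g (\<lambda>m. dd_pow m (y # zs))"
          "divided_difference_sorted g (x # ws) = taylor_app g (\<lambda>m. dd_pow m (x # ws))"
        by (intro less.hyps; simp add: 2)+
      \<comment> \<open>By symmetry the last point \<open>l\<close> may be moved to the front; the
        points shared by all three lists are \<open>ws\<close>.\<close>
      have dd: "(l - x) * dd_pow m xs = dd_pow m (y # zs) - dd_pow m (x # ws)" for m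
      proof -
        have "dd_pow m xs = dd_pow m (l # x # ws)" "dd_pow m (y # zs) = dd_pow m (l # ws)"
          unfolding 2 yzs by (rule dd_pow_cong_mset; simp)+
        then show ?thesis
          by (simp only: dd_pow_diff)
      qed
      have "complex_of_real (l - x) * taylor_app g (\<lambda>m. dd_pow m xs) =
          taylor_app g (\<lambda>m. dd_pow m (y # zs) + (- 1) * dd_pow m (x # ws))"
        unfolding taylor_app_cmult[OF geom_bounded_dd_pow, symmetric] dd by simp
      also have "\<dots> = divided_difference_sorted g (y # zs) - divided_difference_sorted g (x # ws)"
        by (subst taylor_app_add) (simp_all only: geom_bounded_dd_pow geom_bounded_cmult taylor_app_cmult IH, simp)
      finally have "taylor_app g (\<lambda>m. dd_pow m xs) =
          (divided_difference_sorted g (y # zs) - divided_difference_sorted g (x # ws)) / complex_of_real (l - x)"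
        using False by (simp add: field_simps)
      moreover have "divided_difference_sorted g xs =
          (divided_difference_sorted g (y # zs) - divided_difference_sorted g (x # ws)) / complex_of_real (l - x)"
        using False by (simp only: 2 divided_difference_sorted.simps(3) butl l_def[symmetric] if_True not_False_eq_True)
      ultimately show ?thesis
        by simp
    qed
  qed
qed

corollary divided_difference_taylor:
  "xs \<noteq> [] \<Longrightarrow> divided_difference g xs = taylor_app g (\<lambda>m. dd_pow m xs)"
  unfolding divided_difference_def
  by (subst divided_difference_sorted_taylor)
     (metis length_0_conv length_sort, simp_all add: dd_pow_cong_mset[OF mset_sort])

end

section \<open>Positive functionals on polynomials\<close>

interpretation complex_of_real_poly_hom: map_poly_comm_ring_hom complex_of_real ..

text \<open>Linear factors split off one at a time: a new root is not a zero of the product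
  collected so far, hence it is a zero of the cofactor.\<close>

lemma prod_linear_dvd:
  fixes p :: "'a :: field poly"
  assumes "finite R" "\<And>r. r \<in> R \<Longrightarrow> poly p r = 0"
  shows "(\<Prod>r\<in>R. [:- r, 1:]) dvd p"
  using assms
proof (induction R)
  case (insert r R)
  then have "(\<Prod>r\<in>R. [:- r, 1:]) dvd p"
    by simp
  then obtain q where q: "p = (\<Prod>r\<in>R. [:- r, 1:]) * q"
    unfolding dvd_def by blast
  have "poly (\<Prod>r\<in>R. [:- r, 1:]) r \<noteq> 0"
    using insert.hyps by (auto simp: poly_prod)
  then have "[:- r, 1:] dvd q"
    using insert.prems[of r] q by (simp add: dvd_iff_poly_eq_0)
  then show ?case
    unfolding q prod.insert[OF insert.hyps]
    by (subst mult.commute) (rule mult_dvd_mono[OF dvd_refl])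
qed simp

text \<open>The remainder modulo the quadratic is a real polynomial of degree at most one that
  vanishes at the nonreal \<open>z\<close>, so it is zero.\<close>

lemma nonreal_root_quadratic_dvd:
  fixes p :: "real poly"
  assumes root: "poly (map_poly complex_of_real p) z = 0" and "Im z \<noteq> 0"
  shows "[:(Re z)\<^sup>2 + (Im z)\<^sup>2, - 2 * Re z, 1:] dvd p"
proof -
  define q where "q = [:(Re z)\<^sup>2 + (Im z)\<^sup>2, - 2 * Re z, 1:]"
  define r where "r = p mod q"
  have z_q: "poly (map_poly complex_of_real q) z = 0"
    by (simp add: q_def complex_eq_iff map_poly_pCons power2_eq_square algebra_simps)
  have "map_poly complex_of_real p =
      map_poly complex_of_real q * map_poly complex_of_real (p div q) + map_poly complex_of_real r"
    unfolding r_def by (simp flip: complex_of_real_poly_hom.hom_mult complex_of_real_poly_hom.hom_add)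
  with root z_q have r_z: "poly (map_poly complex_of_real r) z = 0"
    by simp
  have "q \<noteq> 0" "degree q = 2"
    by (auto simp: q_def)
  then have "degree r < 2"
    unfolding r_def using degree_mod_less[of q p] by auto
  then have "r = [:coeff r 0, coeff r 1:]"
    by (intro poly_eqI) (auto simp: coeff_pCons coeff_eq_0 split: nat.splits)
  then obtain c d where r: "r = [:c, d:]"
    by blast
  from r_z have "d = 0" "c = 0"
    using assms(2) by (auto simp: r of_real_hom.map_poly_pCons_hom complex_eq_iff)
  then show ?thesis
    unfolding q_def[symmetric] by (simp add: r r_def[symmetric] mod_eq_0_iff_dvd[symmetric])
qed

text \<open>Modelled on the map from \<open>p\<close> to a diagonal entry of \<open>p(B)\<close> for
  positive semidefinite \<open>B\<close>. \<open>L_pCons_square\<close> will confine the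
  representing measure to the half-line, and \<open>ann\<close>, whose multiples \<open>L\<close>
  kills, makes its support finite.\<close>

locale positive_functional =
  fixes L :: "real poly \<Rightarrow> real" and ann :: "real poly"
  assumes L_add: "L (p + q) = L p + L q"
    and L_smult: "L (Polynomial.smult c p) = c * L p"
    and L_square: "0 \<le> L (p * p)"
    and L_pCons_square: "0 \<le> L (pCons 0 (p * p))"
    and ann_nz: "ann \<noteq> 0"
    and L_ann: "L (ann * p) = 0"
begin

lemma L_diff: "L (p - q) = L p - L q"
  using L_add[of p "Polynomial.smult (- 1) q"] L_smult[of "- 1" q] by simp

lemma L_0: "L 0 = 0"
  using L_smult[of 0 0] by simp

lemma L_sum: "L (\<Sum>i\<in>I. f i) = (\<Sum>i\<in>I. L (f i))"
  by (induction I rule: infinite_finite_induct) (simp_all add: L_0 L_add)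

text \<open>If \<open>L (p * q)\<close> were nonzero, the value of \<open>L\<close> at the square of
  \<open>t p + q\<close> would be a nonconstant affine function of \<open>t\<close>, hence negative
  somewhere.\<close>

lemma cauchy_schwarz_zero:
  assumes "L (p * p) = 0"
  shows "L (p * q) = 0"
proof (rule ccontr)
  assume nz: "L (p * q) \<noteq> 0"
  have "0 \<le> 2 * t * L (p * q) + L (q * q)" for t
  proof -
    have "(Polynomial.smult t p + q) * (Polynomial.smult t p + q) = Polynomial.smult (t\<^sup>2) (p * p) + Polynomial.smult (2 * t) (p * q) + q * q"
      by (simp add: poly_eq_poly_eq_iff[symmetric] fun_eq_iff algebra_simps power2_eq_square)
    then show ?thesis
      using L_square[of "Polynomial.smult t p + q"] assms by (simp add: L_add L_smult)
  qed
  \<comment> \<open>At this \<open>t\<close> the affine function takes the value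
    \<open>- 1\<close>.\<close>
  from this[of "- (L (q * q) + 1) / (2 * L (p * q))"] show False
    using nz by (simp add: field_simps)
qed

definition annihilates :: "real poly \<Rightarrow> bool" where
  "annihilates p \<longleftrightarrow> (\<forall>q. L (p * q) = 0)"

lemma minimal_annihilator:
  obtains \<mu> where "\<mu> \<noteq> 0" "annihilates \<mu>"
    "\<And>p. p \<noteq> 0 \<Longrightarrow> annihilates p \<Longrightarrow> degree \<mu> \<le> degree p"
  using ex_has_least_nat[of "\<lambda>p. p \<noteq> 0 \<and> annihilates p" ann degree] ann_nz L_ann
  by (auto simp: annihilates_def L_smult)

text \<open>
  For the minimal annihilator, any root other than a simple nonnegative real one would make
  a proper divisor \<open>\<nu>\<close> satisfy \<open>L (\<nu>\<^sup>2) = 0\<close>, and thus annihilate by Cauchy--Schwarz.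
\<close>

lemma finite_measure:
  obtains R w where "finite R" "\<And>r. r \<in> R \<Longrightarrow> 0 \<le> r" "\<And>r. r \<in> R \<Longrightarrow> 0 \<le> w r"
    "\<And>p. L p = (\<Sum>r\<in>R. w r * poly p r)"
proof -
  obtain \<mu> where \<mu>: "\<mu> \<noteq> 0" "annihilates \<mu>"
    and min: "\<And>p. p \<noteq> 0 \<Longrightarrow> annihilates p \<Longrightarrow> degree \<mu> \<le> degree p"
    using minimal_annihilator by blast
  have no_null_divisor: False if "\<mu> = p * \<nu>" "0 < degree p" "L (\<nu> * \<nu>) = 0" for p \<nu>
  proof -
    have "annihilates \<nu>"
      using that(3) cauchy_schwarz_zero by (auto simp: annihilates_def L_smult)
    moreover have "p \<noteq> 0" "\<nu> \<noteq> 0"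
      using \<mu>(1) that(1) by auto
    ultimately show False
      using min[of \<nu>] that(1,2) by (simp add: degree_mult_eq)
  qed
  define R where "R = {r. poly \<mu> r = 0}"
  have "finite R"
    unfolding R_def using \<mu>(1) by (rule poly_roots_finite)
  have R_nonneg: "0 \<le> r" if r: "r \<in> R" for r
  proof (rule ccontr)
    assume "\<not> 0 \<le> r"
    obtain \<nu> where \<nu>: "\<mu> = [:- r, 1:] * \<nu>"
      using r unfolding R_def mem_Collect_eq poly_eq_0_iff_dvd dvd_def by blast
    have "\<mu> * \<nu> = pCons 0 (\<nu> * \<nu>) - Polynomial.smult r (\<nu> * \<nu>)"
      by (simp add: \<nu> algebra_simps)
    then have "L (pCons 0 (\<nu> * \<nu>)) - r * L (\<nu> * \<nu>) = 0"
      using \<mu>(2) by (metis L_diff L_smult annihilates_def)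
    then have "L (\<nu> * \<nu>) = 0"
      using L_pCons_square[of \<nu>] L_square[of \<nu>] \<open>\<not> 0 \<le> r\<close>
      by (smt (verit) mult_less_0_iff)
    then show False
      using no_null_divisor[OF \<nu>] by simp
  qed
  have no_multiple: False if "[:- r, 1:] * [:- r, 1:] dvd \<mu>" for r
  proof -
    from that obtain \<nu> where \<nu>: "\<mu> = [:- r, 1:] * ([:- r, 1:] * \<nu>)"
      unfolding mult.assoc dvd_def by blast
    have "([:- r, 1:] * \<nu>) * ([:- r, 1:] * \<nu>) = \<mu> * \<nu>"
      by (simp only: \<nu> ac_simps)
    then have "L (([:- r, 1:] * \<nu>) * ([:- r, 1:] * \<nu>)) = 0"
      using \<mu>(2) by (metis annihilates_def)
    then show False
      using no_null_divisor[OF \<nu>] by simp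
  qed
  have roots_real: "Im z = 0" if z: "poly (map_poly complex_of_real \<mu>) z = 0" for z
  proof (rule ccontr)
    assume Im: "Im z \<noteq> 0"
    define a b where "a = Re z" and "b = Im z"
    obtain \<nu> where \<nu>: "\<mu> = [:a\<^sup>2 + b\<^sup>2, - 2 * a, 1:] * \<nu>"
      using nonreal_root_quadratic_dvd[OF z Im] 
      unfolding a_def b_def dvd_def by blast
    have "\<mu> * \<nu> = ([:- a, 1:] * \<nu>) * ([:- a, 1:] * \<nu>) + Polynomial.smult (b\<^sup>2) (\<nu> * \<nu>)"
      unfolding \<nu> by (simp add: poly_eq_poly_eq_iff[symmetric] fun_eq_iff algebra_simps power2_eq_square)
    then have "L (([:- a, 1:] * \<nu>) * ([:- a, 1:] * \<nu>)) + b\<^sup>2 * L (\<nu> * \<nu>) = 0"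
      using \<mu>(2) by (metis L_add L_smult annihilates_def)
    then have "L (\<nu> * \<nu>) = 0"
      using L_square[of "[:- a, 1:] * \<nu>"] L_square[of \<nu>] Im
      by (smt (verit) b_def mult_pos_pos zero_less_power2)
    then show False
      using no_null_divisor[OF \<nu>] by simp
  qed
  define \<pi> where "\<pi> = (\<lambda>R. \<Prod>r\<in>R. [:- r, 1 :: real:])"
  have "\<pi> R dvd \<mu>"
    unfolding \<pi>_def using \<open>finite R\<close> by (intro prod_linear_dvd) (auto simp: R_def)
  then obtain \<kappa> where \<kappa>: "\<mu> = \<pi> R * \<kappa>"
    unfolding dvd_def by blast
  \<comment> \<open>A root of the cofactor \<open>\<kappa>\<close> would be real, hence in
    \<open>R\<close>, hence a multiple root of \<open>\<mu>\<close>.\<close>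
  have "degree (map_poly complex_of_real \<kappa>) = 0"
  proof (rule ccontr)
    assume "degree (map_poly complex_of_real \<kappa>) \<noteq> 0"
    then obtain z where z: "poly (map_poly complex_of_real \<kappa>) z = 0"
      using fundamental_theorem_of_algebra by (metis constant_degree)
    then have "poly (map_poly complex_of_real \<mu>) z = 0"
      by (simp add: \<kappa> complex_of_real_poly_hom.hom_mult)
    then have "z = complex_of_real (Re z)"
      using roots_real by (simp add: complex_eq_iff)
    with z have "poly \<kappa> (Re z) = 0"
      by (metis of_real_eq_0_iff of_real_hom.poly_map_poly)
    moreover from this have "poly \<mu> (Re z) = 0"
      by (subst \<kappa>) simp
    then have "Re z \<in> R"
      by (simp add: R_def)
    ultimately have "[:- Re z, 1:] * [:- Re z, 1:] dvd \<pi> R * \<kappa>"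
      unfolding \<pi>_def using \<open>finite R\<close>
      by (intro mult_dvd_mono dvd_prodI) (simp_all add: poly_eq_0_iff_dvd)
    then show False
      using no_multiple \<kappa> by metis
  qed
  then obtain c where "\<kappa> = [:c:]"
    by (auto elim: degree_eq_zeroE)
  with \<kappa> \<mu>(1) have \<mu>_eq: "\<mu> = Polynomial.smult c (\<pi> R)" "c \<noteq> 0"
    by auto
  have vanish: "L p = 0" if "\<And>r. r \<in> R \<Longrightarrow> poly p r = 0" for p
  proof -
    have "\<pi> R dvd p"
      unfolding \<pi>_def using \<open>finite R\<close> that by (rule prod_linear_dvd)
    then obtain q where "p = \<pi> R * q"
      unfolding dvd_def by blast
    with \<mu>_eq(2) have "p = \<mu> * Polynomial.smult (1 / c) q"
      by (simp add: \<mu>_eq(1))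
    then show ?thesis
      using \<mu>(2) by (auto simp: annihilates_def L_smult)
  qed
  \<comment> \<open>The Lagrange basis for the nodes \<open>R\<close>; the weights of the measure
    are the values \<open>L (l r)\<close>.\<close>
  define l where "l = (\<lambda>r. Polynomial.smult (1 / poly (\<pi> (R - {r})) r) (\<pi> (R - {r})))"
  have poly_l: "poly (l r) s = (if s = r then 1 else 0)" if "r \<in> R" "s \<in> R" for r s
    using that \<open>finite R\<close> by (auto simp: l_def \<pi>_def poly_prod)
  have L_l: "0 \<le> L (l r)" if "r \<in> R" for r
  proof -
    \<comment> \<open>On \<open>R\<close> the polynomial \<open>l r\<close> takes only the values
      \<open>0\<close> and \<open>1\<close>, so it agrees there with its square.\<close>
    have "L (l r - l r * l r) = 0"
      by (rule vanish) (use that in \<open>auto simp: poly_l\<close>)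
    then show ?thesis
      using L_square[of "l r"] by (simp add: L_diff)
  qed
  have "L p = (\<Sum>r\<in>R. L (l r) * poly p r)" for p
  proof -
    have "L (p - (\<Sum>r\<in>R. Polynomial.smult (poly p r) (l r))) = 0"
    proof (rule vanish)
      fix s assume "s \<in> R"
      then have "(\<Sum>r\<in>R. poly p r * poly (l r) s) = (\<Sum>r\<in>R. if r = s then poly p r else 0)"
        by (intro sum.cong) (auto simp: poly_l)
      then show "poly (p - (\<Sum>r\<in>R. Polynomial.smult (poly p r) (l r))) s = 0"
        using \<open>finite R\<close> \<open>s \<in> R\<close> by (simp add: poly_sum)
    qed
    then show ?thesis
      by (simp add: L_diff L_sum L_smult mult.commute)
  qed
  with that[of R "\<lambda>r. L (l r)"] \<open>finite R\<close> R_nonneg L_l show ?thesis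
    by blast
qed

end

section \<open>Walks in a weighted graph\<close>

primrec walks :: "('v \<Rightarrow> 'v \<Rightarrow> real) \<Rightarrow> 'v set \<Rightarrow> nat \<Rightarrow> 'v \<Rightarrow> 'v \<Rightarrow> real" where
  "walks B S 0 i j = (if i = j then 1 else 0)"
| "walks B S (Suc m) i j = (\<Sum>l\<in>S. B i l * walks B S m l j)"

text \<open>In the sum, \<open>a\<close> is the time of the last visit to \<open>i\<close>; the
  first term counts walks that never visit \<open>i\<close>. Its case distinction is needed because
  \<open>walks\<close> does not ask the starting vertex to lie in the set. Induction on the first
  step requires an arbitrary start \<open>u\<close>.\<close>

lemma walks_last_visit:
  assumes "finite S" "i \<in> S" "j \<in> S" "j \<noteq> i"
  shows "walks B S m u j = (if u = i then 0 else walks B (S - {i}) m u j) +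
    (\<Sum>a<m. walks B S a u i * (\<Sum>l\<in>S - {i}. B i l * walks B (S - {i}) (m - 1 - a) l j))"
proof (induction m arbitrary: u)
  case (Suc m)
  define U where "U b = (\<Sum>l\<in>S - {i}. B i l * walks B (S - {i}) b l j)" for b
  have "walks B S (Suc m) u j =
      (\<Sum>v\<in>S. B u v * (if v = i then 0 else walks B (S - {i}) m v j)) +
      (\<Sum>v\<in>S. \<Sum>a<m. B u v * (walks B S a v i * U (m - 1 - a)))"
    by (simp add: Suc U_def algebra_simps sum.distrib sum_distrib_left)
  also have "(\<Sum>v\<in>S. B u v * (if v = i then 0 else walks B (S - {i}) m v j)) =
      (\<Sum>v\<in>S - {i}. B u v * walks B (S - {i}) m v j)"
    using assms by (subst sum.remove[of S i]) auto
  also have "(\<Sum>v\<in>S. \<Sum>a<m. B u v * (walks B S a v i * U (m - 1 - a))) =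
      (\<Sum>a<m. walks B S (Suc a) u i * U (m - 1 - a))"
    by (subst sum.swap) (simp add: sum_distrib_right mult.assoc)
  finally have step: "walks B S (Suc m) u j = (\<Sum>v\<in>S - {i}. B u v * walks B (S - {i}) m v j) +
      (\<Sum>a<m. walks B S (Suc a) u i * U (m - 1 - a))" .
  \<comment> \<open>The term \<open>a = 0\<close> survives only for \<open>u = i\<close>, where it
    equals the first sum in \<open>step\<close>.\<close>
  have "(\<Sum>a<Suc m. walks B S a u i * U (Suc m - 1 - a)) =
      (if u = i then U m else 0) + (\<Sum>a<m. walks B S (Suc a) u i * U (m - 1 - a))"
    by (subst sum.lessThan_Suc_shift) simp
  with step show ?case
    unfolding U_def[symmetric] by (auto simp: U_def)
qed (use assms in auto)

section \<open>Krylov vectors and spectral measures\<close>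

text \<open>The coordinates of \<open>p(B\<^sub>S) e\<^sub>i\<close>.\<close>

definition krylov :: "('v \<Rightarrow> 'v \<Rightarrow> real) \<Rightarrow> 'v set \<Rightarrow> 'v \<Rightarrow> real poly \<Rightarrow> 'v \<Rightarrow> real" where
  "krylov B S i p l = (\<Sum>a\<le>degree p. coeff p a * walks B S a l i)"

lemma krylov_altdef:
  assumes "degree p \<le> N"
  shows "krylov B S i p l = (\<Sum>a\<le>N. coeff p a * walks B S a l i)"
  unfolding krylov_def using assms
  by (intro sum.mono_neutral_left) (auto simp: coeff_eq_0)

lemma krylov_add: "krylov B S i (p + q) l = krylov B S i p l + krylov B S i q l"
proof -
  define N where "N = max (degree p) (degree q)"
  have "degree (p + q) \<le> N" "degree p \<le> N" "degree q \<le> N"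
    by (auto simp: N_def degree_add_le_max)
  then show ?thesis
    by (simp add: krylov_altdef sum.distrib algebra_simps)
qed

lemma krylov_smult: "krylov B S i (Polynomial.smult c p) l = c * krylov B S i p l"
  by (subst krylov_altdef[OF degree_smult_le]) (simp add: krylov_def sum_distrib_left mult.assoc)

lemma krylov_pCons:
  "krylov B S i (pCons c p) l = (if l = i then c else 0) + (\<Sum>k\<in>S. B l k * krylov B S i p k)"
proof -
  have "krylov B S i (pCons c p) l = (\<Sum>a\<le>Suc (degree p). coeff (pCons c p) a * walks B S a l i)"
    by (rule krylov_altdef[OF degree_pCons_le])
  also have "\<dots> = (if l = i then c else 0) + (\<Sum>a\<le>degree p. \<Sum>k\<in>S. coeff p a * (B l k * walks B S a k i))"
    by (subst sum.atMost_Suc_shift) (simp add: sum_distrib_left)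
  also have "(\<Sum>a\<le>degree p. \<Sum>k\<in>S. coeff p a * (B l k * walks B S a k i)) =
      (\<Sum>k\<in>S. B l k * krylov B S i p k)"
    unfolding krylov_def by (subst sum.swap) (simp add: sum_distrib_left mult_ac)
  finally show ?thesis .
qed

lemma krylov_monom: "krylov B S i (monom 1 m) l = walks B S m l i"
  by (subst krylov_altdef[OF degree_monom_le]) (simp add: if_distrib[of "\<lambda>x. x * _"] cong: if_cong)

lemma krylov_0: "krylov B S i 0 l = 0"
  by (simp add: krylov_def)

text \<open>Self-adjointness: the \<open>(i, i)\<close> entry of \<open>(pq)(B)\<close> is the inner
  product of \<open>p(B)\<close> and \<open>q(B)\<close> applied to the unit vector at
  \<open>i\<close>. The induction moves one factor \<open>B\<close> at a time from \<open>p\<close>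
  to \<open>q\<close>, hence the arbitrary \<open>q\<close>.\<close>

lemma krylov_mult:
  assumes "finite S" "i \<in> S" and sym: "\<And>k l. k \<in> S \<Longrightarrow> l \<in> S \<Longrightarrow> B k l = B l k"
  shows "krylov B S i (p * q) i = (\<Sum>l\<in>S. krylov B S i p l * krylov B S i q l)"
proof (induction p arbitrary: q)
  case (pCons c p)
  have "(\<Sum>l\<in>S. krylov B S i (pCons c p) l * krylov B S i q l) =
      (\<Sum>l\<in>S. (if l = i then c else 0) * krylov B S i q l) +
      (\<Sum>l\<in>S. \<Sum>k\<in>S. B l k * krylov B S i p k * krylov B S i q l)"
    by (simp only: krylov_pCons distrib_right sum.distrib sum_distrib_right)
  also have "(\<Sum>l\<in>S. (if l = i then c else 0) * krylov B S i q l) = c * krylov B S i q i"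
    using assms by (subst sum.remove[of S i]) auto
  also have "(\<Sum>l\<in>S. \<Sum>k\<in>S. B l k * krylov B S i p k * krylov B S i q l) =
      (\<Sum>k\<in>S. krylov B S i p k * krylov B S i (pCons 0 q) k)"
    by (subst sum.swap) (auto simp: krylov_pCons sum_distrib_left sym mult_ac intro!: sum.cong)
  also have "\<dots> = krylov B S i (pCons 0 (p * q)) i"
    using pCons.IH[of "pCons 0 q"] by simp
  finally show ?case
    by (simp add: krylov_add krylov_smult)
qed (simp add: krylov_0)

text \<open>The \<open>n + 1\<close> Krylov vectors of degrees \<open>0\<close> to \<open>n\<close>
  live in dimension at most \<open>n\<close>, so they are linearly dependent.\<close>

lemma krylov_annihilator:
  fixes S :: "nat set"
  assumes "S \<subseteq> {..<n}"
  obtains p where "p \<noteq> 0" "\<And>l. l \<in> S \<Longrightarrow> krylov B S i p l = 0"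
proof -
  \<comment> \<open>Rows outside \<open>S\<close> are padded with zeros to get a square matrix. Row
    \<open>n\<close> is always among them, so the determinant vanishes.\<close>
  define K where "K = mat (Suc n) (Suc n) (\<lambda>(l, a). if l \<in> S then walks B S a l i else 0)"
  have K: "K \<in> carrier_mat (Suc n) (Suc n)"
    by (simp add: K_def)
  have "K = mat\<^sub>r (Suc n) (Suc n) (\<lambda>l. if l = n then 0\<^sub>v (Suc n) else row K l)"
    using assms by (intro eq_matI) (auto simp: K_def)
  moreover have "Determinant.det (mat\<^sub>r (Suc n) (Suc n) (\<lambda>l. if l = n then 0\<^sub>v (Suc n) else row K l)) = 0"
    by (rule det_row_0) (auto simp: K_def)
  ultimately have "Determinant.det K = 0"
    by simp
  then obtain v where v: "v \<in> carrier_vec (Suc n)" "v \<noteq> 0\<^sub>v (Suc n)" "K *\<^sub>v v = 0\<^sub>v (Suc n)"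
    using det_0_iff_vec_prod_zero[OF K] by blast
  define p where "p = (\<Sum>a\<le>n. monom (v $ a) a)"
  have coeff_p: "coeff p a = (if a \<le> n then v $ a else 0)" for a
    by (simp add: p_def coeff_sum)
  show thesis
  proof
    show "p \<noteq> 0"
    proof
      assume "p = 0"
      then have "v $ a = 0" if "a \<le> n" for a
        using coeff_p[of a] that by simp
      then have "v = 0\<^sub>v (Suc n)"
        using v(1) by (intro eq_vecI) auto
      with v(2) show False ..
    qed
    have "degree p \<le> n"
      by (rule degree_le) (simp add: coeff_p)
    fix l assume l: "l \<in> S"
    then have "l < Suc n"
      using assms by auto
    have "krylov B S i p l = (\<Sum>a\<le>n. v $ a * walks B S a l i)"
      unfolding krylov_altdef[OF \<open>degree p \<le> n\<close>] by (simp add: coeff_p)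
    also have "\<dots> = (K *\<^sub>v v) $ l"
      using l \<open>l < Suc n\<close> v(1)
      by (auto simp: K_def scalar_prod_def mult.commute atLeast0LessThan lessThan_Suc_atMost intro!: sum.cong)
    also have "\<dots> = 0"
      using v(3) \<open>l < Suc n\<close> by simp
    finally show "krylov B S i p l = 0" .
  qed
qed

text \<open>Replaces the spectral theorem: the Gram form of \<open>B\<close> makes the diagonal
  functional of \<open>p(B)\<close> a \<open>positive_functional\<close>, and
  \<open>finite_measure\<close> is evaluated at monomials.\<close>

lemma walks_spectral_measure:
  fixes S :: "nat set"
  assumes S: "S \<subseteq> {..<n}" and i: "i \<in> S"
    and gram: "\<And>k l. k \<in> S \<Longrightarrow> l \<in> S \<Longrightarrow> B k l = (\<Sum>t\<in>T. M k t * M l t)"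
  shows "\<exists>R w. finite R \<and> (\<forall>r\<in>R. 0 \<le> r \<and> 0 \<le> w r) \<and>
    (\<forall>m. walks B S m i i = (\<Sum>r\<in>R. w r * r ^ m))"
proof -
  have "finite S"
    using S by (rule finite_subset) simp
  have sym: "B k l = B l k" if "k \<in> S" "l \<in> S" for k l
    using that by (simp add: gram mult.commute)
  have mult: "krylov B S i (p * q) i = (\<Sum>l\<in>S. krylov B S i p l * krylov B S i q l)" for p q
    by (rule krylov_mult[OF \<open>finite S\<close> i sym])
  obtain ann where ann: "ann \<noteq> 0" "\<And>l. l \<in> S \<Longrightarrow> krylov B S i ann l = 0"
    using krylov_annihilator[OF S] by metis
  interpret positive_functional "\<lambda>p. krylov B S i p i" ann
  proof
    fix p
    show "0 \<le> krylov B S i (p * p) i"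
      by (simp add: mult sum_nonneg)
    have "krylov B S i (pCons 0 (p * p)) i = krylov B S i (p * pCons 0 p) i"
      by simp
    \<comment> \<open>The quadratic form of \<open>B\<close> at the Krylov vector of
      \<open>p\<close>; the Gram form turns it into a sum of squares indexed by
      \<open>T\<close>.\<close>
    also have "\<dots> = (\<Sum>l\<in>S. \<Sum>k\<in>S. \<Sum>t\<in>T. (M l t * krylov B S i p l) * (M k t * krylov B S i p k))"
      unfolding mult krylov_pCons
      by (auto simp: gram sum_distrib_left sum_distrib_right mult_ac intro!: sum.cong)
    also have "\<dots> = (\<Sum>l\<in>S. \<Sum>t\<in>T. \<Sum>k\<in>S. (M l t * krylov B S i p l) * (M k t * krylov B S i p k))"
      by (intro sum.cong refl sum.swap)
    also have "\<dots> = (\<Sum>t\<in>T. \<Sum>l\<in>S. \<Sum>k\<in>S. (M l t * krylov B S i p l) * (M k t * krylov B S i p k))"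
      by (rule sum.swap)
    also have "\<dots> = (\<Sum>t\<in>T. (\<Sum>l\<in>S. M l t * krylov B S i p l)\<^sup>2)"
      by (simp add: power2_eq_square sum_product)
    also have "\<dots> \<ge> 0"
      by (intro sum_nonneg) auto
    finally show "0 \<le> krylov B S i (pCons 0 (p * p)) i" .
  qed (use ann in \<open>simp_all add: krylov_add krylov_smult mult\<close>)
  obtain R w where R: "finite R" "\<And>r. r \<in> R \<Longrightarrow> 0 \<le> r" "\<And>r. r \<in> R \<Longrightarrow> 0 \<le> w r"
    "\<And>p. krylov B S i p i = (\<Sum>r\<in>R. w r * poly p r)"
    using finite_measure by metis
  have "walks B S m i i = (\<Sum>r\<in>R. w r * r ^ m)" for m
    using R(4)[of "monom 1 m"] by (simp add: krylov_monom poly_monom)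
  with R show ?thesis
    by blast
qed

section \<open>The convex cone generated by divided differences of monomials\<close>

inductive dd_cone :: "nat \<Rightarrow> (nat \<Rightarrow> real) \<Rightarrow> bool" for k where
  dd_cone_zero: "dd_cone k (\<lambda>_. 0)"
| dd_cone_step: "dd_cone k (\<lambda>m. w * dd_pow m xs + u m)"
    if "dd_cone k u" "0 \<le> w" "xs \<noteq> []" "length xs \<le> k" "\<And>x. x \<in> set xs \<Longrightarrow> 0 \<le> x"

lemma dd_cone_add: "dd_cone k u \<Longrightarrow> dd_cone k v \<Longrightarrow> dd_cone k (\<lambda>m. u m + v m)"
  by (induction rule: dd_cone.induct) (auto simp: add.assoc intro: dd_cone_step)

lemma dd_cone_cmult: "dd_cone k u \<Longrightarrow> 0 \<le> c \<Longrightarrow> dd_cone k (\<lambda>m. c * u m)"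
proof (induction rule: dd_cone.induct)
  case (dd_cone_step u w xs)
  then have "dd_cone k (\<lambda>m. c * w * dd_pow m xs + c * u m)"
    by (intro dd_cone.dd_cone_step) auto
  then show ?case
    by (simp add: algebra_simps)
qed (simp add: dd_cone_zero)

lemma dd_cone_sum:
  "(\<And>i. i \<in> I \<Longrightarrow> dd_cone k (u i)) \<Longrightarrow> dd_cone k (\<lambda>m. \<Sum>i\<in>I. u i m)"
  by (induction I rule: infinite_finite_induct) (simp_all add: dd_cone_zero dd_cone_add)

text \<open>By \<open>dd_pow_conv\<close>, the convolution adjoins the point \<open>x\<close> to the
  list of each generator, which raises the order by one.\<close>

lemma dd_cone_conv:
  assumes "dd_cone k u" "0 \<le> x"
  shows "dd_cone (Suc k) (\<lambda>m. \<Sum>a<m. x ^ a * u (m - 1 - a))"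
  using assms(1)
proof (induction rule: dd_cone.induct)
  case (dd_cone_step u w xs)
  then have "dd_cone (Suc k) (\<lambda>m. w * dd_pow m (x # xs) + (\<Sum>a<m. x ^ a * u (m - 1 - a)))"
    using assms(2) by (intro dd_cone.dd_cone_step) auto
  then show ?case
    unfolding dd_pow_conv[OF \<open>xs \<noteq> []\<close>]
    by (simp add: sum_distrib_left sum.distrib algebra_simps)
qed (simp add: dd_cone_zero)

text \<open>Induction on the vertex set: after the last visit to \<open>i\<close> the walk stays in
  \<open>S - {i}\<close>, whose principal submatrix is again a nonnegative Gram matrix. The closed
  part at \<open>i\<close> is a mixture of geometric sequences, each adding one point.\<close>

lemma walks_dd_cone:
  fixes S :: "nat set"
  assumes "S \<subseteq> {..<n}" "i \<in> S" "j \<in> S"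
    and "\<And>k l. k \<in> S \<Longrightarrow> l \<in> S \<Longrightarrow> 0 \<le> B k l"
    and "\<And>k l. k \<in> S \<Longrightarrow> l \<in> S \<Longrightarrow> B k l = (\<Sum>t\<in>T. M k t * M l t)"
  shows "dd_cone (card S) (\<lambda>m. walks B S m i j)"
  using assms
proof (induction "card S" arbitrary: S i j)
  case 0
  then show ?case
    using finite_subset[OF 0(2)] by auto
next
  case (Suc c)
  have "finite S"
    using Suc.prems(1) by (rule finite_subset) simp
  obtain R w where R: "finite R" "\<And>r. r \<in> R \<Longrightarrow> 0 \<le> r" "\<And>r. r \<in> R \<Longrightarrow> 0 \<le> w r"
    and walks: "\<And>m. walks B S m i i = (\<Sum>r\<in>R. w r * r ^ m)"
    using walks_spectral_measure[OF Suc.prems(1,2), where B = B and M = M and T = T] Suc.prems(5) by blast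
  show ?case
  proof (cases "i = j")
    case True
    have "dd_cone (card S) (\<lambda>m. w r * dd_pow m [r] + 0)" if "r \<in> R" for r
      using that R Suc.hyps(2) by (intro dd_cone.intros) auto
    then have "dd_cone (card S) (\<lambda>m. \<Sum>r\<in>R. w r * r ^ m)"
      by (intro dd_cone_sum) simp
    with True walks show ?thesis
      by simp
  next
    case False
    define U where "U m = (\<Sum>l\<in>S - {i}. B i l * walks B (S - {i}) m l j)" for m
    have card: "c = card (S - {i})"
      using Suc.hyps(2) Suc.prems(2) \<open>finite S\<close> by simp
    have "dd_cone c (\<lambda>m. walks B (S - {i}) m l j)" if "l \<in> S - {i}" for l
      unfolding card using Suc.prems False that by (intro Suc.hyps(1)[OF card]) auto
    then have "dd_cone c U"
      unfolding U_def using Suc.prems(2,4) by (intro dd_cone_sum dd_cone_cmult) auto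
    have "walks B S m i j = (\<Sum>r\<in>R. w r * (\<Sum>a<m. r ^ a * U (m - 1 - a)))" for m
    proof -
      have "walks B S m i j = (\<Sum>a<m. walks B S a i i * U (m - 1 - a))"
        using walks_last_visit[OF \<open>finite S\<close> Suc.prems(2,3), of B m i] False by (simp add: U_def)
      also have "\<dots> = (\<Sum>a<m. \<Sum>r\<in>R. w r * (r ^ a * U (m - 1 - a)))"
        by (simp add: walks sum_distrib_right mult.assoc)
      also have "\<dots> = (\<Sum>r\<in>R. \<Sum>a<m. w r * (r ^ a * U (m - 1 - a)))"
        by (rule sum.swap)
      finally show ?thesis
        by (simp only: sum_distrib_left)
    qed
    moreover have "dd_cone (Suc c) (\<lambda>m. \<Sum>r\<in>R. w r * (\<Sum>a<m. r ^ a * U (m - 1 - a)))"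
      using R \<open>dd_cone c U\<close> by (intro dd_cone_sum dd_cone_cmult dd_cone_conv) auto
    ultimately show ?thesis
      using Suc.hyps(2) by simp
  qed
qed

lemma geom_bounded_dd_cone: "dd_cone k u \<Longrightarrow> geom_bounded u"
  by (induction rule: dd_cone.induct)
     (simp_all add: geom_bounded_zero geom_bounded_add geom_bounded_cmult geom_bounded_dd_pow)

lemma taylor_app_dd_cone_nonneg:
  assumes g: "g holomorphic_on UNIV" and "nonneg_divided_differences n g" and "dd_cone n u"
  shows "0 \<le> taylor_app g u"
  using assms(3)
proof (induction rule: dd_cone.induct)
  case (dd_cone_step u w xs)
  have "length xs \<in> {1..n}"
    using dd_cone_step by (cases xs) auto
  then have "0 \<le> divided_difference g xs"
    using assms(2) dd_cone_step unfolding nonneg_divided_differences_def by blast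
  then have "0 \<le> complex_of_real w * taylor_app g (\<lambda>m. dd_pow m xs)"
    using dd_cone_step by (simp add: divided_difference_taylor[OF g] less_eq_complex_def)
  with dd_cone_step.IH have "0 \<le> complex_of_real w * taylor_app g (\<lambda>m. dd_pow m xs) + taylor_app g u"
    by (rule add_nonneg_nonneg[rotated])
  then show ?case
    by (simp add: taylor_app_add[OF g] taylor_app_cmult[OF g] geom_bounded_cmult geom_bounded_dd_pow
        geom_bounded_dd_cone[OF dd_cone_step(1)])
qed (simp add: taylor_app_zero[OF g])

section \<open>Nonnegative divided differences suffice\<close>

lemma walks_Suc_right:
  assumes "finite S" "i \<in> S" "j \<in> S"
  shows "walks B S (Suc m) i j = (\<Sum>l\<in>S. walks B S m i l * B l j)"
  using assms(2)
proof (induction m arbitrary: i)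
  case 0
  have "(\<Sum>l\<in>S. B i l * (if l = j then 1 else 0)) = (\<Sum>l\<in>S. if l = j then B i l else 0)"
    "(\<Sum>l\<in>S. (if i = l then 1 else 0) * B l j) = (\<Sum>l\<in>S. if l = i then B l j else 0)"
    by (auto intro!: sum.cong)
  then show ?case
    using assms 0 by simp
next
  case (Suc m)
  have "walks B S (Suc (Suc m)) i j = (\<Sum>k\<in>S. B i k * (\<Sum>l\<in>S. walks B S m k l * B l j))"
    using Suc.IH by (simp only: walks.simps(2)[of B S "Suc m"] cong: sum.cong)
  also have "\<dots> = (\<Sum>k\<in>S. \<Sum>l\<in>S. B i k * walks B S m k l * B l j)"
    by (simp add: sum_distrib_left mult.assoc)
  also have "\<dots> = (\<Sum>l\<in>S. \<Sum>k\<in>S. B i k * walks B S m k l * B l j)"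
    by (rule sum.swap)
  also have "\<dots> = (\<Sum>l\<in>S. walks B S (Suc m) i l * B l j)"
    by (simp add: sum_distrib_right)
  finally show ?case .
qed

lemma walks_double:
  "walks B S (2 * m) i j = walks (\<lambda>k l. \<Sum>t\<in>S. B k t * B t l) S m i j"
proof (induction m arbitrary: i)
  case (Suc m)
  have "walks B S (2 * Suc m) i j = (\<Sum>t\<in>S. \<Sum>k\<in>S. B i t * (B t k * walks B S (2 * m) k j))"
    by (simp add: sum_distrib_left)
  also have "\<dots> = (\<Sum>k\<in>S. \<Sum>t\<in>S. B i t * (B t k * walks B S (2 * m) k j))"
    by (rule sum.swap)
  also have "\<dots> = walks (\<lambda>k l. \<Sum>t\<in>S. B k t * B t l) S (Suc m) i j"
    by (simp add: Suc sum_distrib_right mult.assoc)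
  finally show ?case .
qed simp

lemma pow_mat_eq_walks:
  assumes A: "A \<in> carrier_mat n n" and "i < n" "j < n"
  shows "(A ^\<^sub>m m) $$ (i, j) = walks (\<lambda>i j. A $$ (i, j)) {..<n} m i j"
  using assms(3)
proof (induction m arbitrary: j)
  case (Suc m)
  have "(A ^\<^sub>m Suc m) $$ (i, j) = (\<Sum>l<n. (A ^\<^sub>m m) $$ (i, l) * A $$ (l, j))"
    using A assms(2) Suc.prems by (simp add: scalar_prod_def atLeast0LessThan)
  also have "\<dots> = (\<Sum>l<n. walks (\<lambda>i j. A $$ (i, j)) {..<n} m i l * A $$ (l, j))"
    by (simp add: Suc.IH)
  also have "\<dots> = walks (\<lambda>i j. A $$ (i, j)) {..<n} (Suc m) i j"
    using assms(2) Suc.prems by (subst walks_Suc_right) auto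
  finally show ?case .
qed (use A assms(2) in auto)

section \<open>Entries of even and odd matrix functions as walk series\<close>

lemma taylor_coeff_unique:
  assumes "\<And>z. (\<lambda>k. F k * z ^ k) sums f z"
  shows "taylor_coeff f k = F k"
proof -
  have "f has_fps_expansion Abs_fps F"
    by (rule has_fps_expansionI) (simp add: assms)
  from fps_nth_fps_expansion[OF this] show ?thesis
    by (simp add: taylor_coeff_altdef)
qed

lemma taylor_coeff_even_function:
  assumes g: "g holomorphic_on UNIV" and f: "\<And>z. f z = g (z\<^sup>2)"
  shows "taylor_coeff f k = (if even k then taylor_coeff g (k div 2) else 0)"
proof (rule taylor_coeff_unique)
  fix z
  have "(\<lambda>m. taylor_coeff g m * z ^ (2 * m)) sums f z"
    using taylor_sums[OF g, of "z\<^sup>2"] by (simp add: f power_mult)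
  then show "(\<lambda>k. (if even k then taylor_coeff g (k div 2) else 0) * z ^ k) sums f z"
    by (subst sums_mono_reindex[of "\<lambda>m. 2 * m", symmetric])
       (auto simp: strict_mono_def elim!: evenE)
qed

lemma taylor_coeff_odd_function:
  assumes h: "h holomorphic_on UNIV" and f: "\<And>z. f z = z * h (z\<^sup>2)"
  shows "taylor_coeff f k = (if odd k then taylor_coeff h (k div 2) else 0)"
proof (rule taylor_coeff_unique)
  fix z
  have "(\<lambda>m. taylor_coeff h m * z ^ (2 * m + 1)) sums f z"
    using sums_mult[OF taylor_sums[OF h, of "z\<^sup>2"], of z] by (simp add: f mult_ac flip: power_mult)
  then show "(\<lambda>k. (if odd k then taylor_coeff h (k div 2) else 0) * z ^ k) sums f z"
    by (subst sums_mono_reindex[of "\<lambda>m. 2 * m + 1", symmetric])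
       (auto simp: strict_mono_def elim!: oddE)
qed

lemma mat_fun_even_function:
  assumes g: "g holomorphic_on UNIV" and f: "\<And>z. f z = g (z\<^sup>2)"
    and A: "A \<in> carrier_mat n n" and "i < n" "j < n"
  shows "mat_fun f A $$ (i, j) =
    taylor_app g (\<lambda>m. walks (\<lambda>i j. A $$ (i, j)) {..<n} (2 * m) i j)"
proof -
  have "mat_fun f A $$ (i, j) = taylor_app f (\<lambda>k. walks (\<lambda>i j. A $$ (i, j)) {..<n} k i j)"
    using assms by (simp add: mat_fun_def taylor_app_def taylor_coeff_def pow_mat_eq_walks)
  also have "\<dots> = taylor_app g (\<lambda>m. walks (\<lambda>i j. A $$ (i, j)) {..<n} (2 * m) i j)"
    unfolding taylor_app_def taylor_coeff_even_function[OF g f]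
    by (subst suminf_mono_reindex[of "\<lambda>m. 2 * m", symmetric]) (auto simp: strict_mono_def elim!: evenE)
  finally show ?thesis .
qed

lemma mat_fun_odd_function:
  assumes h: "h holomorphic_on UNIV" and f: "\<And>z. f z = z * h (z\<^sup>2)"
    and A: "A \<in> carrier_mat n n" and "i < n" "j < n"
  shows "mat_fun f A $$ (i, j) =
    taylor_app h (\<lambda>m. walks (\<lambda>i j. A $$ (i, j)) {..<n} (Suc (2 * m)) i j)"
proof -
  have "mat_fun f A $$ (i, j) = taylor_app f (\<lambda>k. walks (\<lambda>i j. A $$ (i, j)) {..<n} k i j)"
    using assms by (simp add: mat_fun_def taylor_app_def taylor_coeff_def pow_mat_eq_walks)
  also have "\<dots> = taylor_app h (\<lambda>m. walks (\<lambda>i j. A $$ (i, j)) {..<n} (Suc (2 * m)) i j)"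
    unfolding taylor_app_def taylor_coeff_odd_function[OF h f]
    by (subst suminf_mono_reindex[of "\<lambda>m. Suc (2 * m)", symmetric])
       (auto simp: strict_mono_def elim!: oddE simp del: walks.simps)
  finally show ?thesis .
qed

text \<open>Even walks in \<open>A\<close> are walks in its square, and by symmetry the square is
  the Gram matrix of the rows of \<open>A\<close>, even when \<open>A\<close> is indefinite.\<close>

lemma walks_square_dd_cone:
  assumes A: "A \<in> carrier_mat n n" "symmetric_mat A" "nonneg_mat A" and ij: "i < n" "j < n"
  shows "dd_cone n (\<lambda>m. walks (\<lambda>i j. A $$ (i, j)) {..<n} (2 * m) i j)"
proof -
  have nonneg: "0 \<le> A $$ (k, l)" if "k < n" "l < n" for k l
    using A that by (auto simp: nonneg_mat_def)
  have sym: "A $$ (k, l) = A $$ (l, k)" if "k < n" "l < n" for k l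
    using A that unfolding symmetric_mat_def by (metis carrier_matD index_transpose_mat(1))
  have "dd_cone (card {..<n})
      (\<lambda>m. walks (\<lambda>k l. \<Sum>t<n. A $$ (k, t) * A $$ (t, l)) {..<n} m i j)"
    using ij by (intro walks_dd_cone[where n = n and T = "{..<n}" and M = "\<lambda>k t. A $$ (k, t)"])
      (auto intro!: sum_nonneg sum.cong simp: nonneg sym)
  then show ?thesis
    by (simp add: walks_double)
qed

lemma preserves_nonneg_symmetric_even:
  assumes g: "g holomorphic_on UNIV" and f: "\<And>z. f z = g (z\<^sup>2)"
    and dd: "nonneg_divided_differences n g"
  shows "preserves_nonneg_symmetric n f"
  unfolding preserves_nonneg_symmetric_def
proof (intro ballI impI)
  fix A :: "real mat" assume A: "A \<in> carrier_mat n n" "symmetric_mat A" "nonneg_mat A"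
  have "0 \<le> mat_fun f A $$ (i, j)" if "i < n" "j < n" for i j
    unfolding mat_fun_even_function[OF g f A(1) that]
    by (rule taylor_app_dd_cone_nonneg[OF g dd walks_square_dd_cone[OF A that]])
  then show "nonneg_mat (mat_fun f A)"
    using A(1) by (auto simp: nonneg_mat_def mat_fun_def)
qed

lemma preserves_nonneg_symmetric_odd:
  assumes h: "h holomorphic_on UNIV" and f: "\<And>z. f z = z * h (z\<^sup>2)"
    and dd: "nonneg_divided_differences n h"
  shows "preserves_nonneg_symmetric n f"
  unfolding preserves_nonneg_symmetric_def
proof (intro ballI impI)
  fix A :: "real mat" assume A: "A \<in> carrier_mat n n" "symmetric_mat A" "nonneg_mat A"
  have "0 \<le> mat_fun f A $$ (i, j)" if "i < n" "j < n" for i j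
    \<comment> \<open>Peeling off the first step, of nonnegative weight, leaves a walk of even
      length.\<close>
    unfolding mat_fun_odd_function[OF h f A(1) that] walks.simps(2)
    using A that
    by (intro taylor_app_dd_cone_nonneg[OF h dd] dd_cone_sum dd_cone_cmult walks_square_dd_cone)
       (auto simp: nonneg_mat_def)
  then show "nonneg_mat (mat_fun f A)"
    using A(1) by (auto simp: nonneg_mat_def mat_fun_def)
qed

section \<open>Nonnegative divided differences are necessary\<close>

definition antibidiagonal :: "nat \<Rightarrow> real \<Rightarrow> real \<Rightarrow> nat \<Rightarrow> nat \<Rightarrow> real" where
  "antibidiagonal n s e i j = (if i + j + 1 = n then s else if i + j + 2 = n then e else 0)"

text \<open>Column \<open>0\<close> of the powers of the squared matrix, with \<open>e ^ l\<close>
  divided out of row \<open>l\<close>. This rescaling turns the off-diagonal entries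
  \<open>s * e\<close> of the tridiagonal square into \<open>s\<close> below and
  \<open>s * e\<^sup>2\<close> above the diagonal, so \<open>e = 0\<close> is admissible.\<close>

fun antibidiagonal_walks :: "nat \<Rightarrow> real \<Rightarrow> real \<Rightarrow> nat \<Rightarrow> nat \<Rightarrow> real" where
  "antibidiagonal_walks n s e 0 l = (if l = 0 then 1 else 0)"
| "antibidiagonal_walks n s e (Suc m) l =
     (s\<^sup>2 + (if l + 1 < n then e\<^sup>2 else 0)) * antibidiagonal_walks n s e m l +
     (if l = 0 then 0 else s * antibidiagonal_walks n s e m (l - 1)) +
     (if l + 1 < n then s * e\<^sup>2 * antibidiagonal_walks n s e m (l + 1) else 0)"

lemma sum_antibidiagonal:
  assumes "l < n"
  shows "(\<Sum>j<n. antibidiagonal n s e l j * v j) =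
    s * v (n - 1 - l) + (if l + 1 < n then e * v (n - 2 - l) else 0)"
proof -
  have "(\<Sum>j<n. antibidiagonal n s e l j * v j) =
      (\<Sum>j<n. (if j = n - 1 - l then s * v j else 0) + (if l + 1 < n \<and> j = n - 2 - l then e * v j else 0))"
    using assms by (intro sum.cong) (auto simp: antibidiagonal_def)
  also have "\<dots> = s * v (n - 1 - l) + (if l + 1 < n then e * v (n - 2 - l) else 0)"
    using assms by (cases "l + 1 < n") (auto simp: sum.distrib)
  finally show ?thesis .
qed

lemma walks_antibidiagonal:
  assumes "l < n"
  shows "walks (antibidiagonal n s e) {..<n} (2 * m) l 0 = e ^ l * antibidiagonal_walks n s e m l"
  using assms
proof (induction m arbitrary: l)
  case (Suc m)
  define v where "v k = walks (antibidiagonal n s e) {..<n} (2 * m) k 0" for k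
  define v' where "v' k = walks (antibidiagonal n s e) {..<n} (Suc (2 * m)) k 0" for k
  have v': "v' k = s * v (n - 1 - k) + (if k + 1 < n then e * v (n - 2 - k) else 0)" if "k < n" for k
    using sum_antibidiagonal[OF that] by (simp add: v_def v'_def)
  \<comment> \<open>One application of the matrix reflects \<open>l\<close> to
    \<open>n - 1 - l\<close>; the second application reflects back.\<close>
  have 1: "v' (n - 1 - l) = s * v l + (if l = 0 then 0 else e * v (l - 1))"
  proof -
    have "n - 1 - (n - 1 - l) = l" "n - 2 - (n - 1 - l) = l - 1" "n - 1 - l < n" "n - 1 - l + 1 < n \<longleftrightarrow> l \<noteq> 0"
      using Suc.prems by auto
    then show ?thesis
      using v'[of "n - 1 - l"] by (cases "l = 0") simp_all
  qed
  have 2: "v' (n - 2 - l) = s * v (l + 1) + e * v l" if "l + 1 < n"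
    using that by (subst v') (auto simp: diff_diff_left Suc_diff_Suc)
  have "walks (antibidiagonal n s e) {..<n} (2 * Suc m) l 0 =
      s * v' (n - 1 - l) + (if l + 1 < n then e * v' (n - 2 - l) else 0)"
    using sum_antibidiagonal[OF Suc.prems] by (simp add: v'_def)
  also have "\<dots> = (s\<^sup>2 + (if l + 1 < n then e\<^sup>2 else 0)) * v l +
      (if l = 0 then 0 else s * e * v (l - 1)) + (if l + 1 < n then s * e * v (l + 1) else 0)"
    using 1 2 by (auto simp: algebra_simps power2_eq_square numeral_2_eq_2)
  also have "\<dots> = e ^ l * antibidiagonal_walks n s e (Suc m) l"
  proof -
    have "v l = e ^ l * antibidiagonal_walks n s e m l"
      "l \<noteq> 0 \<Longrightarrow> e * v (l - 1) = e ^ l * antibidiagonal_walks n s e m (l - 1)"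
      "l + 1 < n \<Longrightarrow> v (l + 1) = e ^ l * (e * antibidiagonal_walks n s e m (l + 1))"
      using Suc by (auto simp: v_def power_eq_if)
    then show ?thesis
      by (auto simp: algebra_simps power2_eq_square)
  qed
  finally show ?case .
qed auto

text \<open>At \<open>e = 0\<close> the recursion is lower bidiagonal with constant diagonal
  \<open>s\<^sup>2\<close>: up to powers of \<open>s\<close>, it is the Leibniz equation for
  coinciding points.\<close>

lemma antibidiagonal_walks_0:
  "antibidiagonal_walks n s 0 m l = s ^ l * dd_pow m (replicate (Suc l) (s\<^sup>2))"
proof (induction m arbitrary: l)
  case (Suc m)
  show ?case
    by (cases l) (simp_all add: Suc algebra_simps power2_eq_square)
qed (auto simp: dd_pow_0)

text \<open>The three coefficients sum to at most \<open>s\<^sup>2 + 1 + 2 * s\<close>. Uniformity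
  in \<open>e\<close> is what dominated convergence requires.\<close>

lemma antibidiagonal_walks_bound:
  assumes "0 \<le> s" "0 \<le> e" "e \<le> 1"
  shows "\<bar>antibidiagonal_walks n s e m l\<bar> \<le> ((1 + s)\<^sup>2) ^ m"
proof (induction m arbitrary: l)
  case (Suc m)
  define R where "R = ((1 + s)\<^sup>2) ^ m"
  have "0 \<le> R"
    by (simp add: R_def)
  have "e\<^sup>2 \<le> 1"
    using assms by (simp add: power_le_one)
  have IH: "\<bar>antibidiagonal_walks n s e m k\<bar> \<le> R" for k
    unfolding R_def by (rule Suc)
  have 1: "\<bar>(s\<^sup>2 + (if l + 1 < n then e\<^sup>2 else 0)) * antibidiagonal_walks n s e m l\<bar> \<le> (s\<^sup>2 + 1) * R"
    unfolding abs_mult using \<open>e\<^sup>2 \<le> 1\<close> by (intro mult_mono IH) auto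
  have 2: "\<bar>if l = 0 then 0 else s * antibidiagonal_walks n s e m (l - 1)\<bar> \<le> s * R"
    using assms IH \<open>0 \<le> R\<close> by (auto simp: abs_mult intro!: mult_mono)
  have "s * e\<^sup>2 \<le> s * 1"
    using assms \<open>e\<^sup>2 \<le> 1\<close> by (intro mult_left_mono) auto
  then have 3: "\<bar>if l + 1 < n then s * e\<^sup>2 * antibidiagonal_walks n s e m (l + 1) else 0\<bar> \<le> s * R"
    using assms IH[of "l + 1"] \<open>0 \<le> R\<close> by (auto simp: abs_mult intro!: mult_mono)
  have "\<bar>antibidiagonal_walks n s e (Suc m) l\<bar> \<le> (s\<^sup>2 + 1) * R + s * R + s * R"
    unfolding antibidiagonal_walks.simps
    by (intro order.trans[OF abs_triangle_ineq] add_mono 1 2 3)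
  also have "\<dots> = ((1 + s)\<^sup>2) ^ Suc m"
    by (simp add: R_def power2_eq_square algebra_simps)
  finally show ?case .
qed auto

lemma continuous_antibidiagonal_walks:
  "continuous_on UNIV (\<lambda>e. antibidiagonal_walks n s e m l)"
proof (induction m arbitrary: l)
  case (Suc m)
  show ?case
    using Suc by (cases "l = 0"; cases "l + 1 < n") (auto intro!: continuous_intros)
qed simp

lemma geom_bounded_antibidiagonal_walks:
  assumes "0 \<le> s" "0 \<le> e" "e \<le> 1"
  shows "geom_bounded (\<lambda>m. antibidiagonal_walks n s e m l)"
  using antibidiagonal_walks_bound[OF assms, of n _ l]
  by (intro geom_boundedI[of _ 1 "(1 + s)\<^sup>2"]) auto

lemma complex_nonneg_cancel:
  fixes z :: complex
  assumes "0 < r" "0 \<le> complex_of_real r * z"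
  shows "0 \<le> z"
  using assms by (auto simp: less_eq_complex_def zero_le_mult_iff)

lemma complex_nonneg_limit:
  fixes f :: "'a \<Rightarrow> complex"
  assumes "(f \<longlongrightarrow> c) F" "F \<noteq> bot" "eventually (\<lambda>x. 0 \<le> f x) F"
  shows "0 \<le> c"
proof -
  have Re: "((\<lambda>x. Re (f x)) \<longlongrightarrow> Re c) F" and Im: "((\<lambda>x. Im (f x)) \<longlongrightarrow> Im c) F"
    using assms(1) by (auto intro: tendsto_intros)
  have "0 \<le> Re c"
    using assms(3) by (intro tendsto_lowerbound[OF Re _ assms(2)]) (auto simp: less_eq_complex_def elim: eventually_mono)
  moreover have "((\<lambda>x. Im (f x)) \<longlongrightarrow> 0) F"
    using assms(3) by (intro tendsto_eventually) (auto simp: less_eq_complex_def elim: eventually_mono)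
  then have "Im c = 0"
    using tendsto_unique[OF assms(2) Im] by simp
  ultimately show ?thesis
    by (simp add: less_eq_complex_def)
qed

text \<open>Tannery's theorem allows \<open>e\<close> to tend to \<open>0\<close> inside the series;
  the limit is \<open>s ^ l / fact l\<close> times the derivative at
  \<open>s\<^sup>2\<close>.\<close>

lemma higher_deriv_nonneg_if_antibidiagonal:
  assumes h: "h holomorphic_on UNIV"
    and nonneg: "\<And>s e. 0 < s \<Longrightarrow> 0 < e \<Longrightarrow> e < 1 \<Longrightarrow> 0 \<le> taylor_app h (\<lambda>m. antibidiagonal_walks n s e m l)"
    and "0 \<le> x"
  shows "0 \<le> (deriv ^^ l) h (complex_of_real x)"
proof -
  have pos: "0 \<le> (deriv ^^ l) h (complex_of_real x)" if "0 < x" for x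
  proof -
    define s where "s = sqrt x"
    have s: "0 < s" "s\<^sup>2 = x"
      using that by (auto simp: s_def)
    have small: "eventually (\<lambda>e. e \<in> {0<..<1}) (at_right (0 :: real))"
      by (rule eventually_at_right_real) simp
    have lim: "((\<lambda>e. taylor_app h (\<lambda>m. antibidiagonal_walks n s e m l)) \<longlongrightarrow>
        taylor_app h (\<lambda>m. antibidiagonal_walks n s 0 m l)) (at_right 0)"
      unfolding taylor_app_def
    proof (rule tannerys_theorem[THEN conjunct2, THEN conjunct2])
      show "((\<lambda>e. taylor_coeff h m * complex_of_real (antibidiagonal_walks n s e m l)) \<longlongrightarrow>
          taylor_coeff h m * complex_of_real (antibidiagonal_walks n s 0 m l)) (at_right 0)" for m
        using continuous_antibidiagonal_walks[of n s m l]
        unfolding continuous_on_def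
        by (intro tendsto_intros) (blast intro: tendsto_mono[OF at_le[OF subset_UNIV]])
      from small have *: "eventually (\<lambda>e. \<forall>m. norm (taylor_coeff h m * complex_of_real (antibidiagonal_walks n s e m l)) \<le>
          norm (taylor_coeff h m) * ((1 + s)\<^sup>2) ^ m) (at_right 0)"
        by eventually_elim (use s in \<open>auto simp: norm_mult intro!: mult_left_mono antibidiagonal_walks_bound\<close>)
      show "eventually (\<lambda>(m, e). norm (taylor_coeff h m * complex_of_real (antibidiagonal_walks n s e m l)) \<le>
          norm (taylor_coeff h m) * ((1 + s)\<^sup>2) ^ m) (at_top \<times>\<^sub>F at_right 0)"
        using eventually_prodI[OF eventually_True[of sequentially] *]
        by (rule eventually_mono) (simp add: case_prod_unfold)
      show "summable (\<lambda>m. norm (taylor_coeff h m) * ((1 + s)\<^sup>2) ^ m)"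
        by (rule summable_taylor_norm[OF h]) simp
    qed auto
    have "eventually (\<lambda>e. 0 \<le> taylor_app h (\<lambda>m. antibidiagonal_walks n s e m l)) (at_right 0)"
      using small by eventually_elim (use nonneg[OF s(1)] in auto)
    then have "0 \<le> taylor_app h (\<lambda>m. antibidiagonal_walks n s 0 m l)"
      by (rule complex_nonneg_limit[OF lim, rotated]) simp
    also have "\<dots> = complex_of_real (s ^ l) * ((deriv ^^ l) h (complex_of_real x) / fact l)"
      unfolding antibidiagonal_walks_0 higher_deriv_taylor[OF h] s
      by (rule taylor_app_cmult[OF h geom_bounded_dd_pow])
    also have "\<dots> = complex_of_real (s ^ l / fact l) * (deriv ^^ l) h (complex_of_real x)"
      by simp
    finally show ?thesis
      by (rule complex_nonneg_cancel[rotated]) (use s(1) in simp)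
  qed
  show ?thesis
  proof (cases "x = 0")
    \<comment> \<open>Here \<open>s\<close> would be \<open>0\<close> and the factor
      \<open>s ^ l\<close> could hide the derivative, so continuity from the right is used.\<close>
    case True
    have "(deriv ^^ l) h holomorphic_on UNIV"
      by (rule holomorphic_higher_deriv[OF h]) auto
    then have "continuous_on UNIV (\<lambda>x. (deriv ^^ l) h (complex_of_real x))"
      by (rule continuous_on_compose2[OF holomorphic_on_imp_continuous_on]) (simp_all add: continuous_on_of_real)
    then have "((\<lambda>x. (deriv ^^ l) h (complex_of_real x)) \<longlongrightarrow> (deriv ^^ l) h (complex_of_real 0)) (at_right 0)"
      unfolding continuous_on_def by (blast intro: tendsto_mono[OF at_le[OF subset_UNIV]])
    then show ?thesis
      unfolding True
      by (rule complex_nonneg_limit) (simp_all add: eventually_at_filter pos)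
  qed (use pos \<open>0 \<le> x\<close> in auto)
qed

section \<open>From nonnegative derivatives to nonnegative divided differences\<close>

lemma divided_difference_sorted_shift:
  assumes g: "g holomorphic_on UNIV"
  shows "divided_difference_sorted (\<lambda>z. g (z + complex_of_real c)) xs =
    divided_difference_sorted g (map (\<lambda>x. x + c) xs)"
proof (induction "length xs" arbitrary: xs rule: less_induct)
  case less
  consider "xs = []" | x where "xs = [x]" | x y zs where "xs = x # y # zs"
    by (metis neq_Nil_conv)
  then show ?case
  proof cases
    case (3 x y zs)
    define ys where "ys = y # zs"
    have ys: "ys \<noteq> []" "length ys < length xs" "length (butlast (x # ys)) < length xs"
      by (auto simp: ys_def 3)
    have deriv: "(deriv ^^ k) (\<lambda>z. g (z + complex_of_real c)) (complex_of_real x) =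
        (deriv ^^ k) g (complex_of_real (x + c))" for k
      using higher_deriv_compose_linear'[OF g open_UNIV open_UNIV, of "complex_of_real x" 1 "complex_of_real c" k]
      by simp
    have dd: "divided_difference_sorted G (u # us) = (if u \<noteq> last us
      then (divided_difference_sorted G us - divided_difference_sorted G (butlast (u # us))) / complex_of_real (last us - u)
      else (deriv ^^ length us) G (complex_of_real u) / fact (length us))" if "us \<noteq> []" for G u us
      using that by (cases us) simp_all
    have last: "last (map (\<lambda>x. x + c) ys) = last ys + c"
      using ys by (simp add: last_map)
    have IH: "divided_difference_sorted (\<lambda>z. g (z + complex_of_real c)) ys =
        divided_difference_sorted g (map (\<lambda>x. x + c) ys)"
      "divided_difference_sorted (\<lambda>z. g (z + complex_of_real c)) (butlast (x # ys)) =
        divided_difference_sorted g (butlast ((x + c) # map (\<lambda>x. x + c) ys))"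
      using less.hyps[OF ys(2)] less.hyps[OF ys(3)] ys(1) by (simp_all add: map_butlast)
    have "divided_difference_sorted (\<lambda>z. g (z + complex_of_real c)) (x # ys) =
        divided_difference_sorted g ((x + c) # map (\<lambda>x. x + c) ys)"
      using ys(1) by (subst (1 2) dd) (use deriv[of "length ys"] in \<open>auto simp: IH last simp del: butlast.simps\<close>)
    then show ?thesis
      by (simp add: 3 ys_def)
  qed auto
qed

text \<open>The complex order also demands equal imaginary parts; these follow from monotonicity in
  both directions, since the imaginary part of the derivative vanishes.\<close>

lemma complex_nonneg_deriv_mono:
  fixes \<phi> :: "real \<Rightarrow> complex"
  assumes "a \<le> b"
    and deriv: "\<And>t. a \<le> t \<Longrightarrow> t \<le> b \<Longrightarrow> (\<phi> has_vector_derivative \<phi>' t) (at t)"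
    and nonneg: "\<And>t. a \<le> t \<Longrightarrow> t \<le> b \<Longrightarrow> 0 \<le> \<phi>' t"
  shows "\<phi> a \<le> \<phi> b"
proof -
  have "Re (\<phi> a) \<le> Re (\<phi> b)"
    using \<open>a \<le> b\<close>
  proof (rule DERIV_nonneg_imp_nondecreasing)
    fix t assume t: "a \<le> t" "t \<le> b"
    show "\<exists>y. ((\<lambda>t. Re (\<phi> t)) has_real_derivative y) (at t) \<and> 0 \<le> y"
      using has_field_derivative_Re[OF deriv[OF t]] nonneg[OF t] by (auto simp: less_eq_complex_def)
  qed
  moreover have "Im (\<phi> a) \<le> Im (\<phi> b)"
    using \<open>a \<le> b\<close>
  proof (rule DERIV_nonneg_imp_nondecreasing)
    fix t assume t: "a \<le> t" "t \<le> b"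
    show "\<exists>y. ((\<lambda>t. Im (\<phi> t)) has_real_derivative y) (at t) \<and> 0 \<le> y"
      using has_field_derivative_Im[OF deriv[OF t]] nonneg[OF t] by (auto simp: less_eq_complex_def)
  qed
  moreover have "Im (\<phi> b) \<le> Im (\<phi> a)"
    using \<open>a \<le> b\<close>
  proof (rule DERIV_nonpos_imp_nonincreasing)
    fix t assume t: "a \<le> t" "t \<le> b"
    show "\<exists>y. ((\<lambda>t. Im (\<phi> t)) has_real_derivative y) (at t) \<and> y \<le> 0"
      using has_field_derivative_Im[OF deriv[OF t]] nonneg[OF t] by (auto simp: less_eq_complex_def)
  qed
  ultimately show ?thesis
    by (simp add: less_eq_complex_def)
qed

text \<open>
  The Hermite--Genocchi argument: for \<open>G z = g (z + x\<^sub>0)\<close> and \<open>u\<^sub>i = x\<^sub>i - x\<^sub>0\<close>, the function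
  \<open>t\<^sup>k G[0, t u\<^sub>1, \<dots>, t u\<^sub>k]\<close> has derivative \<open>t\<^bsup>k-1\<^esup> G'[t u\<^sub>1, \<dots>, t u\<^sub>k]\<close>, and it vanishes at \<open>0\<close>.
\<close>

lemma divided_difference_sorted_nonneg:
  assumes "g holomorphic_on UNIV" "xs \<noteq> []" "sorted xs" "\<And>x. x \<in> set xs \<Longrightarrow> 0 \<le> x"
    and "\<And>j x. j < length xs \<Longrightarrow> 0 \<le> x \<Longrightarrow> 0 \<le> (deriv ^^ j) g (complex_of_real x)"
  shows "0 \<le> divided_difference_sorted g xs"
  using assms
proof (induction "length xs" arbitrary: g xs rule: less_induct)
  case less
  obtain x ys where xs: "xs = x # ys"
    using less.prems(2) by (cases xs) auto
  show ?case
  proof (cases "ys = []")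
    case True
    then show ?thesis
      using less.prems(4) less.prems(5)[of 0 x] by (simp add: xs)
  next
    case False
    then obtain k where k: "length ys = Suc k"
      by (cases ys) auto
    define G where "G = (\<lambda>z. g (z + complex_of_real x))"
    define us where "us = map (\<lambda>y. y - x) ys"
    have G: "G holomorphic_on UNIV"
      unfolding G_def by (intro holomorphic_on_compose_gen[OF _ less.prems(1), unfolded o_def] holomorphic_intros) auto
    then have dG: "deriv G holomorphic_on UNIV"
      by (rule holomorphic_deriv) simp
    have us: "us \<noteq> []" "sorted us" "length us = Suc k" "\<And>u. u \<in> set us \<Longrightarrow> 0 \<le> u"
      using False k less.prems(3) by (auto simp: us_def xs sorted_map intro: sorted_wrt_mono_rel[of ys "(\<le>)"])
    have coeff_dG: "taylor_coeff (deriv G) m = of_nat (Suc m) * taylor_coeff G (Suc m)" for m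
      by (simp add: taylor_coeff_altdef funpow_swap1 field_simps del: of_nat_Suc)
    \<comment> \<open>By homogeneity (\<open>dd_pow_scale\<close>), \<open>\<Phi>\<close> at real
      \<open>t\<close> is \<open>t ^ Suc k\<close> times the divided difference of \<open>G\<close>
      at \<open>0\<close> and the points \<open>t * u\<close>. As a power series in \<open>t\<close>
      it can be differentiated termwise.\<close>
    define a where "a m = taylor_coeff G m * complex_of_real (dd_pow m (0 # us))" for m
    define \<Phi> where "\<Phi> z = (\<Sum>m. a m * z ^ m)" for z
    have deriv_\<Phi>: "((\<lambda>t. \<Phi> (complex_of_real t)) has_vector_derivative
        (\<Sum>m. diffs a m * complex_of_real t ^ m)) (at t)" for t
      unfolding \<Phi>_def
    proof (rule has_vector_derivative_real_field, rule termdiffs_strong_converges_everywhere)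
      fix y :: complex
      obtain R where R: "\<And>u. u \<in> set (0 # us) \<Longrightarrow> \<bar>u\<bar> \<le> R" "0 \<le> R"
        by (metis List.finite_set abs_ge_zero finite_imageI Max_ge imageI list.set_intros(1) order_trans)
      have "summable (\<lambda>m. norm (taylor_coeff G m) * ((R + 1) * norm y) ^ m)"
        by (rule summable_taylor_norm[OF G]) (use R in simp)
      then show "summable (\<lambda>m. a m * y ^ m)"
      proof (rule summable_comparison_test'[where N = 0])
        fix m
        have "\<bar>dd_pow m (0 # us)\<bar> \<le> (R + 1) ^ m"
          by (rule dd_pow_bound[OF R])
        then show "norm (a m * y ^ m) \<le> norm (taylor_coeff G m) * ((R + 1) * norm y) ^ m"
          by (auto simp: a_def norm_mult norm_power power_mult_distrib mult.assoc intro!: mult_left_mono mult_right_mono)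
      qed
    qed
    have deriv_eq: "(\<Sum>m. diffs a m * complex_of_real t ^ m) =
        complex_of_real (t ^ k) * divided_difference_sorted (deriv G) (map ((*) t) us)" if "0 \<le> t" for t
    proof -
      \<comment> \<open>At the point \<open>0\<close> the Leibniz equation is a pure shift:
        \<open>dd_pow (Suc m) (0 # us) = dd_pow m us\<close>.\<close>
      have diffs: "diffs a m * complex_of_real t ^ m = taylor_coeff (deriv G) m *
          complex_of_real (t ^ k * dd_pow m (map ((*) t) us))" for m
        unfolding dd_pow_scale[OF us(3)]
        by (simp add: diffs_def a_def coeff_dG mult_ac)
      have "sorted (map ((*) t) us)"
        using us(2) that by (auto simp: sorted_map intro: sorted_wrt_mono_rel[of us "(\<le>)"] mult_left_mono)
      then have "divided_difference_sorted (deriv G) (map ((*) t) us) =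
          taylor_app (deriv G) (\<lambda>m. dd_pow m (map ((*) t) us))"
        using us(1) by (intro divided_difference_sorted_taylor[OF dG]) auto
      then show ?thesis
        unfolding diffs taylor_app_def[of "deriv G" "\<lambda>m. t ^ k * dd_pow m (map ((*) t) us)", symmetric]
        by (simp only: taylor_app_cmult[OF dG geom_bounded_dd_pow])
    qed
    have IH: "0 \<le> divided_difference_sorted (deriv G) (map ((*) t) us)" if "0 \<le> t" for t
    proof (rule less.hyps[OF _ dG])
      show "sorted (map ((*) t) us)"
        using us(2) that by (auto simp: sorted_map intro: sorted_wrt_mono_rel[of us "(\<le>)"] mult_left_mono)
      fix j and y :: real
      assume j: "j < length (map ((*) t) us)" and "0 \<le> y"
      have "(deriv ^^ j) (deriv G) (complex_of_real y) = (deriv ^^ Suc j) G (complex_of_real y)"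
        by (simp add: funpow_swap1)
      also have "\<dots> = (deriv ^^ Suc j) g (complex_of_real (y + x))"
        using higher_deriv_compose_linear'[OF less.prems(1) open_UNIV open_UNIV,
            of "complex_of_real y" 1 "complex_of_real x" "Suc j"]
        by (simp add: G_def)
      also have "0 \<le> \<dots>"
        using j us(3) k \<open>0 \<le> y\<close> less.prems(4)[of x] by (intro less.prems(5)) (auto simp: xs)
      finally show "0 \<le> (deriv ^^ j) (deriv G) (complex_of_real y)" .
    qed (use us k that xs in auto)
    have "\<Phi> (complex_of_real 0) \<le> \<Phi> (complex_of_real 1)"
    proof (rule complex_nonneg_deriv_mono[OF _ deriv_\<Phi>])
      fix t :: real assume "0 \<le> t"
      then show "0 \<le> (\<Sum>m. diffs a m * complex_of_real t ^ m)"
        unfolding deriv_eq[OF \<open>0 \<le> t\<close>] using IH[OF \<open>0 \<le> t\<close>]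
        by (simp add: less_eq_complex_def flip: of_real_power)
    qed simp
    \<comment> \<open>The constant coefficient contains a divided difference of the constant
      \<open>1\<close> at two or more points.\<close>
    moreover have "\<Phi> 0 = 0"
      using us(1) by (simp add: \<Phi>_def a_def dd_pow_0)
    moreover have "\<Phi> 1 = divided_difference_sorted G (0 # us)"
      using us by (subst divided_difference_sorted_taylor[OF G]) (auto simp: \<Phi>_def a_def taylor_app_def)
    moreover have "divided_difference_sorted G (0 # us) = divided_difference_sorted g xs"
      unfolding G_def divided_difference_sorted_shift[OF less.prems(1)] by (simp add: us_def xs o_def)
    ultimately show ?thesis
      by simp
  qed
qed

lemma nonneg_divided_differences_if_derivs:
  assumes "g holomorphic_on UNIV"
    and "\<And>l x. l < n \<Longrightarrow> 0 \<le> x \<Longrightarrow> 0 \<le> (deriv ^^ l) g (complex_of_real x)"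
  shows "nonneg_divided_differences n g"
  unfolding nonneg_divided_differences_def divided_difference_def
proof (intro ballI allI impI)
  fix k and xs :: "real list"
  assume "k \<in> {1..n}" "length xs = k" "\<forall>x\<in>set xs. 0 \<le> x"
  then show "0 \<le> divided_difference_sorted g (sort xs)"
    using assms by (intro divided_difference_sorted_nonneg) (auto simp flip: length_greater_0_conv)
qed

section \<open>Testing preservation on antibidiagonal matrices\<close>

lemma antibidiagonal_mat:
  fixes n s e
  assumes "0 < s" "0 < e"
  defines "A \<equiv> mat n n (\<lambda>(i, j). antibidiagonal n s e i j)"
  shows "A \<in> carrier_mat n n" "symmetric_mat A" "nonneg_mat A"
proof -
  show "A \<in> carrier_mat n n"
    by (simp add: A_def)
  show "symmetric_mat A"
    unfolding symmetric_mat_def by (rule eq_matI) (simp_all add: A_def antibidiagonal_def add.commute)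
  show "nonneg_mat A"
    using assms(1,2) by (simp add: nonneg_mat_def A_def antibidiagonal_def)
qed

lemma walks_cong:
  assumes "\<And>i j. i \<in> S \<Longrightarrow> j \<in> S \<Longrightarrow> B i j = B' i j" "i \<in> S"
  shows "walks B S m i j = walks B' S m i j"
  using assms(2) by (induction m arbitrary: i) (auto simp: assms(1) intro!: sum.cong)

lemma antibidiagonal_mat_walks:
  assumes "l < n"
  shows "walks (\<lambda>i j. mat n n (\<lambda>(i, j). antibidiagonal n s e i j) $$ (i, j)) {..<n} (2 * m) l 0 =
      e ^ l * antibidiagonal_walks n s e m l"
    and "walks (\<lambda>i j. mat n n (\<lambda>(i, j). antibidiagonal n s e i j) $$ (i, j)) {..<n} (Suc (2 * m)) l (n - 1) =
      s * e ^ l * antibidiagonal_walks n s e m l"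
proof -
  let ?B = "antibidiagonal n s e"
  have cong: "walks (\<lambda>i j. mat n n (\<lambda>(i, j). ?B i j) $$ (i, j)) {..<n} k l j = walks ?B {..<n} k l j" for k j
    using assms by (intro walks_cong) auto
  show "walks (\<lambda>i j. mat n n (\<lambda>(i, j). ?B i j) $$ (i, j)) {..<n} (2 * m) l 0 =
      e ^ l * antibidiagonal_walks n s e m l"
    unfolding cong by (rule walks_antibidiagonal[OF assms])
  have "walks ?B {..<n} (Suc (2 * m)) l (n - 1) = (\<Sum>k<n. walks ?B {..<n} (2 * m) l k * ?B k (n - 1))"
    using assms by (intro walks_Suc_right) auto
  \<comment> \<open>The last column of the matrix has a single nonzero entry \<open>s\<close>, in
    row \<open>0\<close>, so the odd case reduces to the even one.\<close>
  also have "\<dots> = (\<Sum>k<n. if k = 0 then walks ?B {..<n} (2 * m) l k * s else 0)"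
    by (intro sum.cong) (auto simp: antibidiagonal_def)
  also have "\<dots> = s * e ^ l * antibidiagonal_walks n s e m l"
    using assms by (simp add: walks_antibidiagonal)
  finally show "walks (\<lambda>i j. mat n n (\<lambda>(i, j). ?B i j) $$ (i, j)) {..<n} (Suc (2 * m)) l (n - 1) =
      s * e ^ l * antibidiagonal_walks n s e m l"
    unfolding cong .
qed

lemma taylor_app_cmult_nonneg_cancel:
  assumes "g holomorphic_on UNIV" "geom_bounded u" "0 < c" "0 \<le> taylor_app g (\<lambda>m. c * u m)"
  shows "0 \<le> taylor_app g u"
  using assms by (metis complex_nonneg_cancel taylor_app_cmult)

text \<open>Entry \<open>(l, 0)\<close> tests the derivative of order \<open>l\<close>; the
  \<open>n\<close> rows supply exactly the derivatives that divided differences at up to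
  \<open>n\<close> points call for.\<close>

lemma nonneg_divided_differences_even:
  assumes g: "g holomorphic_on UNIV" and f: "\<And>z. f z = g (z\<^sup>2)"
    and pres: "preserves_nonneg_symmetric n f"
  shows "nonneg_divided_differences n g"
proof (rule nonneg_divided_differences_if_derivs[OF g], rule higher_deriv_nonneg_if_antibidiagonal[OF g])
  fix l and s e :: real
  assume l: "l < n" and se: "0 < s" "0 < e" "e < 1"
  define A where "A = mat n n (\<lambda>(i, j). antibidiagonal n s e i j)"
  note A = antibidiagonal_mat[OF se(1,2), of n, folded A_def]
  have "nonneg_mat (mat_fun f A)"
    using pres A by (simp add: preserves_nonneg_symmetric_def)
  then have "0 \<le> mat_fun f A $$ (l, 0)"
    using A l by (auto simp: nonneg_mat_def mat_fun_def)
  then have "0 \<le> taylor_app g (\<lambda>m. e ^ l * antibidiagonal_walks n s e m l)"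
    using l mat_fun_even_function[OF g f A(1), of l 0]
    unfolding A_def antibidiagonal_mat_walks(1)[OF l] by simp
  then show "0 \<le> taylor_app g (\<lambda>m. antibidiagonal_walks n s e m l)"
    by (rule taylor_app_cmult_nonneg_cancel[OF g, rotated 2])
       (use se in \<open>simp_all add: geom_bounded_antibidiagonal_walks\<close>)
qed auto

lemma nonneg_divided_differences_odd:
  assumes h: "h holomorphic_on UNIV" and f: "\<And>z. f z = z * h (z\<^sup>2)"
    and pres: "preserves_nonneg_symmetric n f"
  shows "nonneg_divided_differences n h"
proof (rule nonneg_divided_differences_if_derivs[OF h], rule higher_deriv_nonneg_if_antibidiagonal[OF h])
  fix l and s e :: real
  assume l: "l < n" and se: "0 < s" "0 < e" "e < 1"
  define A where "A = mat n n (\<lambda>(i, j). antibidiagonal n s e i j)"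
  note A = antibidiagonal_mat[OF se(1,2), of n, folded A_def]
  have "nonneg_mat (mat_fun f A)"
    using pres A by (simp add: preserves_nonneg_symmetric_def)
  then have "0 \<le> mat_fun f A $$ (l, n - 1)"
    using A l by (auto simp: nonneg_mat_def mat_fun_def)
  then have "0 \<le> taylor_app h (\<lambda>m. s * e ^ l * antibidiagonal_walks n s e m l)"
    using l mat_fun_odd_function[OF h f A(1), of l "n - 1"]
    unfolding A_def antibidiagonal_mat_walks(2)[OF l] by simp
  then show "0 \<le> taylor_app h (\<lambda>m. antibidiagonal_walks n s e m l)"
    by (rule taylor_app_cmult_nonneg_cancel[OF h, rotated 2])
       (use se in \<open>simp_all add: geom_bounded_antibidiagonal_walks\<close>)
qed auto

theorem theorem17:
  fixes n :: nat
  shows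
    "(\<forall>f g. g holomorphic_on UNIV \<longrightarrow> (\<forall>z. f z = g (z\<^sup>2)) \<longrightarrow>
        (preserves_nonneg_symmetric n f \<longleftrightarrow> nonneg_divided_differences n g))
     \<and>
     (\<forall>f h. h holomorphic_on UNIV \<longrightarrow> (\<forall>z. f z = z * h (z\<^sup>2)) \<longrightarrow>
        (preserves_nonneg_symmetric n f \<longleftrightarrow> nonneg_divided_differences n h))"
  using preserves_nonneg_symmetric_even nonneg_divided_differences_even
    preserves_nonneg_symmetric_odd nonneg_divided_differences_odd
  by blast

end
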